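(* There exists a function $F:\mathbb{S}\to\mathcal{O}(\mathbb{B})$ that is Markov-computable but not K-computable.
   Context: $\mathbb{S}=\{\bot,\top\}$ is the Sierpiński space with topology $\{\emptyset,\{\top\},\mathbb{S}\}$, viewed as an effective topological space with basis $\{\mathbb{S},\{\top\}\}$; both points are computable. A Type-2 name of a point is a $p\in\mathbb{N}^{\mathbb{N}}$ whose range is the set of indices of basic open sets containing the point; a Markov name is an index $e$ of a total computable Type-2 name $\varphi_e$; $K(s)$ is the length of a shortest program computing a Type-2 name of $s$; a K-name of $s$ is a pair $(k,p)$ with $k\geq K(s)$ and $p$ a Type-2 name of $s$. $\mathbb{B}=\mathbb{N}^{\mathbb{N}}$ is Baire space and $\mathcal{O}(\mathbb{B})$ its set of open subsets; an $\mathcal{O}(\mathbb{B})$-name of an open set $U$ is an enumeration (on a one-way output tape) of a set of finite sequences $u$ whose cylinders $[u]$ have union $U$. For R $\in\{$Markov, K$\}$, $F$ is R-computable if there is a Turing machine which, given any R-name of any $s\in\mathbb{S}$, outputs an $\mathcal{O}(\mathbb{B})$-name of $F(s)$. *)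

theory Defs
  imports
    "HOL-Analysis.Function_Topology"
    "HOL-Library.Nat_Bijection"
    "HOL-Library.Extended_Nat"
    "HOL-Library.Discrete_Functions"
begin

text \<open>
  A machine has a one-way read-only input tape over \<open>{0,1}\<close> (\<^typ>\<open>bool\<close>, blank is \<^const>\<open>False\<close>),
  finitely many two-way infinite work tapes, and a one-way write-only output tape over \<open>{0,1}\<close>.
  Work-tape symbols are natural numbers with blank \<open>0\<close>; since the table is finite, only finitely
  many of them occur. A work tape \<open>(l, r)\<close> has the cells left of the head in \<open>l\<close> (nearest first)
  and the scanned cell followed by the cells to its right in \<open>r\<close>; all other cells are blank.
\<close>

datatype move = Stay | Left | Right

type_synonym tape = "nat list \<times> nat list"

text \<open>
  \<open>r_work\<close> holds, for each work tape, the symbol that has to be read, the symbol to be written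
  and the head move.
\<close>

record rule =
  r_state :: nat
  r_input :: bool
  r_work :: "(nat \<times> nat \<times> move) list"
  r_next :: nat
  r_advance :: bool
  r_emit :: "bool option"

record machine =
  n_tapes :: nat
  rules :: "rule list"

record config =
  state :: nat
  pos :: nat
  tapes :: "tape list"
  out :: "bool list"

fun first_sym :: "nat list \<Rightarrow> nat" where
  "first_sym [] = 0"
| "first_sym (x # xs) = x"

fun scanned :: "tape \<Rightarrow> nat" where
  "scanned (l, r) = first_sym r"

fun tape_op :: "nat \<times> nat \<times> move \<Rightarrow> tape \<Rightarrow> tape" where
  "tape_op (a, b, Stay) (l, r) = (l, b # tl r)"
| "tape_op (a, b, Left) (l, r) = (tl l, first_sym l # b # tl r)"
| "tape_op (a, b, Right) (l, r) = (b # l, tl r)"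

definition applicable :: "(nat \<Rightarrow> bool) \<Rightarrow> config \<Rightarrow> rule \<Rightarrow> bool" where
  "applicable inp c r \<longleftrightarrow>
     r_state r = state c \<and> r_input r = inp (pos c) \<and> map fst (r_work r) = map scanned (tapes c)"

definition apply_rule :: "rule \<Rightarrow> config \<Rightarrow> config" where
  "apply_rule r c =
     \<lparr>state = r_next r,
      pos = (if r_advance r then Suc (pos c) else pos c),
      tapes = map2 tape_op (r_work r) (tapes c),
      out = out c @ (case r_emit r of None \<Rightarrow> [] | Some b \<Rightarrow> [b])\<rparr>"

text \<open>Machines are deterministic: the first applicable rule of the table is used.\<close>

definition step :: "machine \<Rightarrow> (nat \<Rightarrow> bool) \<Rightarrow> config \<Rightarrow> config" where
  "step M inp c =
     (case find (applicable inp c) (rules M) of None \<Rightarrow> c | Some r \<Rightarrow> apply_rule r c)"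

definition halted :: "machine \<Rightarrow> (nat \<Rightarrow> bool) \<Rightarrow> config \<Rightarrow> bool" where
  "halted M inp c \<longleftrightarrow> find (applicable inp c) (rules M) = None"

definition init :: "machine \<Rightarrow> config" where
  "init M = \<lparr>state = 0, pos = 0, tapes = replicate (n_tapes M) ([], []), out = []\<rparr>"

definition run :: "machine \<Rightarrow> (nat \<Rightarrow> bool) \<Rightarrow> nat \<Rightarrow> config" where
  "run M inp t = (step M inp ^^ t) (init M)"

text \<open>
  Input tapes: a number \<open>n\<close> is written \<open>1\<^sup>n 0 0 0 \<dots>\<close>, a sequence \<open>p\<close> is written
  \<open>1\<^bsup>p(0)\<^esup> 0 1\<^bsup>p(1)\<^esup> 0 \<dots>\<close>. In the latter the \<open>n\<close>-th separator is in cell \<open>n + (p(0) + \<dots> + p(n))\<close>.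
\<close>

definition nat_input :: "nat \<Rightarrow> nat \<Rightarrow> bool" where
  "nat_input n i \<longleftrightarrow> i < n"

definition seq_input :: "(nat \<Rightarrow> nat) \<Rightarrow> nat \<Rightarrow> bool" where
  "seq_input p i \<longleftrightarrow> \<not> (\<exists>n. i = n + (\<Sum>j\<le>n. p j))"

definition computes :: "machine \<Rightarrow> (nat \<Rightarrow> nat) \<Rightarrow> bool" where
  "computes M p \<longleftrightarrow>
     (\<forall>n. \<exists>t. halted M (nat_input n) (run M (nat_input n) t) \<and>
              out (run M (nat_input n) t) = replicate (p n) True)"

text \<open>
  The numbers listed by an output word \<open>1\<^sup>a 0 1\<^sup>b 0 \<dots>\<close> are \<open>a, b, \<dots>\<close>; an unfinished last block
  does not count. The first argument is the number of \<open>1\<close>s already read in the current block.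
\<close>

fun blocks :: "nat \<Rightarrow> bool list \<Rightarrow> nat list" where
  "blocks c [] = []"
| "blocks c (True # w) = blocks (Suc c) w"
| "blocks c (False # w) = c # blocks 0 w"

text \<open>
  The machine may go on writing forever; it may also list only finitely many numbers, or none.
\<close>

definition enumerates :: "machine \<Rightarrow> (nat \<Rightarrow> bool) \<Rightarrow> nat set" where
  "enumerates M inp = (\<Union>t. set (blocks 0 (out (run M inp t))))"


text \<open>A Goedel numbering of all machines.\<close>

definition decode_move :: "nat \<Rightarrow> move" where
  "decode_move n = (if n = 0 then Stay else if n = 1 then Left else Right)"

definition decode_work :: "nat \<Rightarrow> nat \<times> nat \<times> move" where
  "decode_work n = (let (a, n1) = prod_decode n; (b, d) = prod_decode n1 in (a, b, decode_move d))"

definition decode_emit :: "nat \<Rightarrow> bool option" where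
  "decode_emit n = (if n = 0 then None else Some (n \<noteq> 1))"

definition decode_rule :: "nat \<Rightarrow> rule" where
  "decode_rule n =
     (let (q, n1) = prod_decode n;
          (a, n2) = prod_decode n1;
          (w, n3) = prod_decode n2;
          (q', n4) = prod_decode n3;
          (d, b) = prod_decode n4
      in \<lparr>r_state = q, r_input = (a \<noteq> 0), r_work = map decode_work (list_decode w),
          r_next = q', r_advance = (d \<noteq> 0), r_emit = decode_emit b\<rparr>)"

definition decode_machine :: "nat \<Rightarrow> machine" where
  "decode_machine e =
     (let (k, n) = prod_decode e in \<lparr>n_tapes = k, rules = map decode_rule (list_decode n)\<rparr>)"

lemma surj_map_list_decode:
  assumes "surj f"
  shows "\<exists>n. map f (list_decode n) = xs"
proof -
  have "map f (list_decode (list_encode (map (inv f) xs))) = xs"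
    using assms by (simp add: surj_iff)
  then show ?thesis by blast
qed

lemma surj_decode_move: "surj decode_move"
proof (rule surjI)
  show "decode_move (case m of Stay \<Rightarrow> 0 | Left \<Rightarrow> 1 | Right \<Rightarrow> 2) = m" for m
    by (cases m) (auto simp: decode_move_def)
qed

lemma surj_decode_work: "surj decode_work"
proof -
  have "\<exists>n. decode_work n = (a, b, d)" for a b d
  proof -
    obtain m where "decode_move m = d" using surj_decode_move by (metis surjD)
    then have "decode_work (prod_encode (a, prod_encode (b, m))) = (a, b, d)"
      by (simp add: decode_work_def)
    then show ?thesis by blast
  qed
  then show ?thesis unfolding surj_def by (metis prod_cases3)
qed

lemma surj_decode_emit: "surj decode_emit"
proof (rule surjI)
  show "decode_emit (case x of None \<Rightarrow> 0 | Some b \<Rightarrow> if b then 2 else 1) = x" for x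
    by (auto simp: decode_emit_def split: option.splits)
qed

lemma surj_decode_rule: "surj decode_rule"
proof -
  have "\<exists>n. decode_rule n = r" for r
  proof -
    obtain w where w: "map decode_work (list_decode w) = r_work r"
      using surj_map_list_decode[OF surj_decode_work] by blast
    obtain b where b: "decode_emit b = r_emit r" using surj_decode_emit by (metis surjD)
    have "decode_rule (prod_encode (r_state r, prod_encode (of_bool (r_input r),
            prod_encode (w, prod_encode (r_next r, prod_encode (of_bool (r_advance r), b)))))) = r"
      by (simp add: decode_rule_def w b)
    then show ?thesis by blast
  qed
  then show ?thesis unfolding surj_def by metis
qed

lemma surj_decode_machine: "surj decode_machine"
proof -
  have "\<exists>e. decode_machine e = M" for M
  proof -
    obtain n where n: "map decode_rule (list_decode n) = rules M"
      using surj_map_list_decode[OF surj_decode_rule] by blast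
    have "decode_machine (prod_encode (n_tapes M, n)) = M"
      by (simp add: decode_machine_def n)
    then show ?thesis by blast
  qed
  then show ?thesis unfolding surj_def by metis
qed


datatype sierpinski = Bot | Top

instantiation sierpinski :: topological_space
begin

definition open_sierpinski :: "sierpinski set \<Rightarrow> bool" where
  "open_sierpinski U \<longleftrightarrow> U \<in> {{}, {Top}, UNIV}"

instance
proof
  show "open (UNIV :: sierpinski set)" by (simp add: open_sierpinski_def)
next
  fix S T :: "sierpinski set"
  assume "open S" "open T"
  then show "open (S \<inter> T)" by (auto simp: open_sierpinski_def)
next
  fix K :: "sierpinski set set"
  assume K: "\<forall>S\<in>K. open S"
  show "open (\<Union>K)"
  proof (cases "UNIV \<in> K")
    case True
    then have "\<Union>K = UNIV" by blast
    then show ?thesis by (simp add: open_sierpinski_def)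
  next
    case False
    then have "K \<subseteq> {{}, {Top}}" using K by (auto simp: open_sierpinski_def)
    then have "\<Union>K \<subseteq> {Top}" by blast
    then have "\<Union>K = {} \<or> \<Union>K = {Top}" by (rule subset_singletonD)
    then show ?thesis by (auto simp: open_sierpinski_def)
  qed
qed

end

definition sierpinski_base :: "sierpinski set list" where
  "sierpinski_base = [UNIV, {Top}]"

lemma topological_basis_sierpinski_base: "topological_basis (set sierpinski_base)"
  unfolding topological_basis_def
proof (intro conjI ballI allI impI)
  show "open B" if "B \<in> set sierpinski_base" for B
    using that by (auto simp: sierpinski_base_def open_sierpinski_def)
  show "\<exists>B'\<subseteq>set sierpinski_base. \<Union>B' = U" if "open U" for U
  proof -
    have "U = {} \<or> U = {Top} \<or> U = UNIV" using that by (simp add: open_sierpinski_def)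
    then have "\<Union>{B \<in> set sierpinski_base. B \<subseteq> U} = U"
      by (auto simp: sierpinski_base_def)
    then show ?thesis by (intro exI[of _ "{B \<in> set sierpinski_base. B \<subseteq> U}"]) auto
  qed
qed

definition type2_name :: "(nat \<Rightarrow> nat) \<Rightarrow> sierpinski \<Rightarrow> bool" where
  "type2_name p s \<longleftrightarrow> range p = {i. i < length sierpinski_base \<and> s \<in> sierpinski_base ! i}"

definition markov_name :: "nat \<Rightarrow> sierpinski \<Rightarrow> bool" where
  "markov_name e s \<longleftrightarrow> (\<exists>p. computes (decode_machine e) p \<and> type2_name p s)"

lemma ex_markov_name_Bot: "\<exists>e. markov_name e Bot"
proof -
  obtain e where e: "decode_machine e = \<lparr>n_tapes = 0, rules = []\<rparr>"
    using surj_decode_machine by (metis surjD)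
  have "computes (decode_machine e) (\<lambda>n. 0)"
    unfolding computes_def e
    by (auto simp: halted_def run_def init_def intro!: exI[of _ 0])
  moreover have "type2_name (\<lambda>n. 0) Bot"
    by (auto simp: type2_name_def sierpinski_base_def less_Suc_eq numeral_2_eq_2)
  ultimately show ?thesis unfolding markov_name_def by blast
qed

lemma ex_markov_name_Top: "\<exists>e. markov_name e Top"
proof -
  let ?r = "\<lparr>r_state = 0, r_input = True, r_work = [], r_next = 1,
              r_advance = True, r_emit = Some True\<rparr>"
  let ?p = "\<lambda>n::nat. if n = 0 then 0 else 1::nat"
  obtain e where e: "decode_machine e = \<lparr>n_tapes = 0, rules = [?r]\<rparr>"
    using surj_decode_machine by (metis surjD)
  have "computes (decode_machine e) ?p"
    unfolding computes_def e
    by (auto simp: halted_def run_def init_def step_def applicable_def apply_rule_def nat_input_def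
      intro!: exI[of _ 1])
  moreover have "type2_name ?p Top"
    by (auto simp: type2_name_def sierpinski_base_def less_Suc_eq numeral_2_eq_2 image_iff)
  ultimately show ?thesis unfolding markov_name_def by blast
qed

text \<open>
  Programs are binary words, identified with natural numbers in length-lexicographic order;
  the word number \<open>e\<close> has length \<open>\<lfloor>log\<^sub>2 (e + 1)\<rfloor>\<close>.
\<close>

definition program_length :: "nat \<Rightarrow> nat" where
  "program_length e = floor_log (Suc e)"

definition K :: "sierpinski \<Rightarrow> enat" where
  "K s = (INF e \<in> {e. markov_name e s}. enat (program_length e))"

definition K_name :: "nat \<Rightarrow> (nat \<Rightarrow> nat) \<Rightarrow> sierpinski \<Rightarrow> bool" where
  "K_name k p s \<longleftrightarrow> enat k \<ge> K s \<and> type2_name p s"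


definition cylinder :: "nat list \<Rightarrow> (nat \<Rightarrow> nat) set" where
  "cylinder u = {x. \<forall>i<length u. x i = u ! i}"

definition outputs_open :: "machine \<Rightarrow> (nat \<Rightarrow> bool) \<Rightarrow> (nat \<Rightarrow> nat) set \<Rightarrow> bool" where
  "outputs_open M inp U \<longleftrightarrow> U = (\<Union>c\<in>enumerates M inp. cylinder (list_decode c))"

definition markov_computable :: "(sierpinski \<Rightarrow> (nat \<Rightarrow> nat) set) \<Rightarrow> bool" where
  "markov_computable F \<longleftrightarrow>
     (\<exists>M. \<forall>s e. markov_name e s \<longrightarrow> outputs_open M (nat_input e) (F s))"

text \<open>The name \<open>(k, p)\<close> is given to the machine as the sequence \<open>k, p(0), p(1), \<dots>\<close>.\<close>

definition K_computable :: "(sierpinski \<Rightarrow> (nat \<Rightarrow> nat) set) \<Rightarrow> bool" where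
  "K_computable F \<longleftrightarrow>
     (\<exists>M. \<forall>s k p. K_name k p s \<longrightarrow> outputs_open M (seq_input (case_nat k p)) (F s))"

end

theory Submission
  imports Defs "HOL-Library.While_Combinator"
begin

text \<open>
  A K-computable function is monotone: one bound on \<open>K\<close> serves both points, and whatever is listed
  for \<open>Bot\<close> is listed after reading finitely many zeros, which also begin a name of \<open>Top\<close>. So it
  suffices to find a Markov-computable function that is not monotone.

  Call \<open>(n, t)\<close> a certificate for the program \<open>e\<close> if \<open>e\<close> has written something on input \<open>n\<close> after
  \<open>t\<close> steps: programs of \<open>Top\<close> have certificates, programs of \<open>Bot\<close> have none. Let \<open>F(Bot)\<close> be Baire
  space, and let \<open>F(Top)\<close> consist of those \<open>y\<close> such that \<open>y(e)\<close> is no certificate for some \<open>e\<close> that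
  has certificates; choosing a certificate wherever there is one gives a point outside \<open>F(Top)\<close>.
  Given \<open>e\<close>, list all \<open>y\<close> such that \<open>y(e)\<close> is no certificate for \<open>e\<close>; this is Baire space if \<open>e\<close>
  names \<open>Bot\<close> and part of \<open>F(Top)\<close> if \<open>e\<close> names \<open>Top\<close>. Once a certificate for \<open>e\<close> shows up, list all
  of \<open>F(Top)\<close>.

  Listing needs a universal machine, which is obtained by compiling loop programs on registers to
  machines with one counter per work tape.
\<close>

section \<open>Loop programs\<close>

datatype com = Skip | Inc nat | Dec nat | Emit bool | Seq com com (infixr ";;" 60)
  | Cond nat com com | Loop nat com

type_synonym store = "(nat \<Rightarrow> nat) \<times> bool list"

fun assign :: "nat \<Rightarrow> nat \<Rightarrow> store \<Rightarrow> store" where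
  "assign r v (s, w) = (s(r := v), w)"

lemma fst_assign: "fst (assign r v \<sigma>) = (fst \<sigma>)(r := v)"
  by (cases \<sigma>) simp

lemma assign_assign: "assign r v (assign r u \<sigma>) = assign r v \<sigma>"
  by (cases \<sigma>) simp

lemma assign_triv: "fst \<sigma> r = v \<Longrightarrow> assign r v \<sigma> = \<sigma>"
  by (cases \<sigma>) auto

lemma assign_twist: "q \<noteq> r \<Longrightarrow> assign q u (assign r v \<sigma>) = assign r v (assign q u \<sigma>)"
  by (cases \<sigma>) (simp add: fun_upd_twist)

primrec exec :: "com \<Rightarrow> store \<Rightarrow> store" where
  "exec Skip \<sigma> = \<sigma>"
| "exec (Inc r) \<sigma> = assign r (Suc (fst \<sigma> r)) \<sigma>"
| "exec (Dec r) \<sigma> = assign r (fst \<sigma> r - 1) \<sigma>"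
| "exec (Emit b) \<sigma> = apsnd (\<lambda>w. w @ [b]) \<sigma>"
| "exec (c ;; d) \<sigma> = exec d (exec c \<sigma>)"
| "exec (Cond r c d) \<sigma> = (if fst \<sigma> r = 0 then exec d \<sigma> else exec c \<sigma>)"
| "exec (Loop r c) \<sigma> = assign r 0 ((exec c ^^ fst \<sigma> r) \<sigma>)"

primrec regs :: "com \<Rightarrow> nat set" where
  "regs Skip = {}"
| "regs (Inc r) = {r}"
| "regs (Dec r) = {r}"
| "regs (Emit b) = {}"
| "regs (c ;; d) = regs c \<union> regs d"
| "regs (Cond r c d) = insert r (regs c \<union> regs d)"
| "regs (Loop r c) = insert r (regs c)"

text \<open>
  Since the body of a loop must not use the loop register, it makes no difference that the compiled
  loop counts this register down.
\<close>

primrec wf_com :: "com \<Rightarrow> bool" where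
  "wf_com Skip = True"
| "wf_com (Inc r) = True"
| "wf_com (Dec r) = True"
| "wf_com (Emit b) = True"
| "wf_com (c ;; d) = (wf_com c \<and> wf_com d)"
| "wf_com (Cond r c d) = (wf_com c \<and> wf_com d)"
| "wf_com (Loop r c) = (wf_com c \<and> r \<notin> regs c)"

lemma exec_assign:
  assumes "r \<notin> regs c"
  shows "exec c (assign r v \<sigma>) = assign r v (exec c \<sigma>)"
  using assms
proof (induction c arbitrary: \<sigma>)
  case (Loop q c)
  then have "(exec c ^^ n) (assign r v \<sigma>) = assign r v ((exec c ^^ n) \<sigma>)" for n
    by (intro funpow_commute[symmetric]) simp
  then show ?case
    using Loop.prems by (simp add: fst_assign assign_twist)
next
  case (Emit b)
  show ?case by (cases \<sigma>) simp
qed (simp_all add: fst_assign assign_twist)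

lemma funpow_exec_assign:
  "r \<notin> regs c \<Longrightarrow> (exec c ^^ n) (assign r v \<sigma>) = assign r v ((exec c ^^ n) \<sigma>)"
  by (intro funpow_commute[symmetric]) (simp add: exec_assign)

section \<open>Compilation to jumping programs\<close>

datatype instr = INC nat | DEC nat | EMIT bool | JZ nat nat | JMP nat | READ nat

type_synonym instr_state = "nat \<times> nat \<times> store"

fun instr_regs :: "instr \<Rightarrow> nat set" where
  "instr_regs (INC r) = {r}"
| "instr_regs (DEC r) = {r}"
| "instr_regs (JZ r p) = {r}"
| "instr_regs _ = {}"

fun exec_instr :: "(nat \<Rightarrow> bool) \<Rightarrow> instr \<Rightarrow> instr_state \<Rightarrow> instr_state" where
  "exec_instr inp (INC r) (pc, i, s, w) = (Suc pc, i, s(r := Suc (s r)), w)"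
| "exec_instr inp (DEC r) (pc, i, s, w) = (Suc pc, i, s(r := s r - 1), w)"
| "exec_instr inp (EMIT b) (pc, i, s, w) = (Suc pc, i, s, w @ [b])"
| "exec_instr inp (JZ r p) (pc, i, s, w) = (if s r = 0 then p else Suc pc, i, s, w)"
| "exec_instr inp (JMP p) (pc, i, s, w) = (p, i, s, w)"
| "exec_instr inp (READ p) (pc, i, s, w) = (if inp i then (Suc pc, Suc i, s, w) else (p, i, s, w))"

definition instr_step :: "instr list \<Rightarrow> (nat \<Rightarrow> bool) \<Rightarrow> instr_state \<Rightarrow> instr_state \<Rightarrow> bool" where
  "instr_step P inp a b \<longleftrightarrow> fst a < length P \<and> b = exec_instr inp (P ! fst a) a"

primrec code_at :: "instr list \<Rightarrow> nat \<Rightarrow> instr list \<Rightarrow> bool" where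
  "code_at P n [] \<longleftrightarrow> True"
| "code_at P n (ins # C) \<longleftrightarrow> n < length P \<and> P ! n = ins \<and> code_at P (Suc n) C"

lemma code_at_append: "code_at P n (C @ D) \<longleftrightarrow> code_at P n C \<and> code_at P (n + length C) D"
  by (induction C arbitrary: n) auto

lemma code_at_whole: "code_at P 0 P"
proof -
  have "code_at (A @ C) (length A) C" for A C
  proof (induction C arbitrary: A)
    case (Cons ins C)
    from Cons[of "A @ [ins]"] show ?case by simp
  qed simp
  from this[of "[]"] show ?thesis by simp
qed

lemma instr_stepI:
  "code_at P n [ins] \<Longrightarrow> exec_instr inp ins (n, x) = b \<Longrightarrow> instr_step P inp (n, x) b"
  by (simp add: instr_step_def)

primrec compile :: "com \<Rightarrow> nat \<Rightarrow> instr list" where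
  "compile Skip n = []"
| "compile (Inc r) n = [INC r]"
| "compile (Dec r) n = [DEC r]"
| "compile (Emit b) n = [EMIT b]"
| "compile (c ;; d) n = compile c n @ compile d (n + length (compile c n))"
| "compile (Cond r c d) n =
     (let C = compile c (n + 1); m = n + 2 + length C; D = compile d m
      in JZ r m # C @ JMP (m + length D) # D)"
| "compile (Loop r c) n =
     (let C = compile c (n + 2) in JZ r (n + 3 + length C) # DEC r # C @ [JMP n])"

lemma instr_regs_compile: "ins \<in> set (compile c n) \<Longrightarrow> instr_regs ins \<subseteq> regs c"
  by (induction c arbitrary: n) (fastforce simp: Let_def)+

definition executes_at :: "instr list \<Rightarrow> (nat \<Rightarrow> bool) \<Rightarrow> nat \<Rightarrow> com \<Rightarrow> bool" where
  "executes_at P inp n c \<longleftrightarrow> (\<forall>i \<sigma>.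
     (instr_step P inp)\<^sup>*\<^sup>* (n, i, \<sigma>) (n + length (compile c n), i, exec c \<sigma>))"

lemma executes_atD:
  "executes_at P inp n c \<Longrightarrow>
   (instr_step P inp)\<^sup>*\<^sup>* (n, i, \<sigma>) (n + length (compile c n), i, exec c \<sigma>)"
  unfolding executes_at_def by blast

lemma executes_at_single:
  assumes "compile c n = [ins]" "code_at P n [ins]"
    and "\<And>i s w. exec_instr inp ins (n, i, s, w) = (Suc n, i, exec c (s, w))"
  shows "executes_at P inp n c"
  using assms by (auto simp: executes_at_def intro!: r_into_rtranclp instr_stepI)

lemma executes_at_Seq:
  assumes c: "executes_at P inp n c" and d: "executes_at P inp (n + length (compile c n)) d"
  shows "executes_at P inp n (c ;; d)"
  unfolding executes_at_def
proof (intro allI)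
  fix i \<sigma>
  note executes_atD[OF c]
  also note executes_atD[OF d]
  finally show "(instr_step P inp)\<^sup>*\<^sup>* (n, i, \<sigma>)
      (n + length (compile (c ;; d) n), i, exec (c ;; d) \<sigma>)"
    by (simp add: add.assoc)
qed

lemma executes_at_Cond:
  fixes c d r n
  defines "C \<equiv> compile c (n + 1)"
  defines "m \<equiv> n + 2 + length C"
  assumes code: "code_at P n (compile (Cond r c d) n)"
    and c: "executes_at P inp (n + 1) c" and d: "executes_at P inp m d"
  shows "executes_at P inp n (Cond r c d)"
proof -
  let ?R = "instr_step P inp"
  let ?exit = "m + length (compile d m)"
  have JZ: "code_at P n [JZ r m]" and JMP: "code_at P (n + 1 + length C) [JMP ?exit]"
    using code by (auto simp: Let_def code_at_append C_def m_def)
  have "?R\<^sup>*\<^sup>* (n, i, \<sigma>) (?exit, i, exec (Cond r c d) \<sigma>)" for i \<sigma>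
  proof (cases "fst \<sigma> r = 0")
    case True
    then have "?R (n, i, \<sigma>) (m, i, \<sigma>)"
      by (intro instr_stepI[OF JZ]) (cases \<sigma>, simp)
    also have "?R\<^sup>*\<^sup>* \<dots> (?exit, i, exec d \<sigma>)" using d by (rule executes_atD)
    finally show ?thesis using True by simp
  next
    case False
    then have "?R (n, i, \<sigma>) (n + 1, i, \<sigma>)"
      by (intro instr_stepI[OF JZ]) (cases \<sigma>, simp)
    also have "?R\<^sup>*\<^sup>* \<dots> (n + 1 + length C, i, exec c \<sigma>)"
      unfolding C_def using c by (rule executes_atD)
    also have "?R \<dots> (?exit, i, exec c \<sigma>)"
      by (intro instr_stepI[OF JMP]) (cases "exec c \<sigma>", simp)
    finally show ?thesis using False by simp
  qed
  moreover have "n + length (compile (Cond r c d) n) = ?exit"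
    by (simp add: Let_def C_def m_def)
  ultimately show ?thesis unfolding executes_at_def by (simp only:) blast
qed

lemma loop_round:
  assumes code: "code_at P n (compile (Loop r c) n)" and r: "r \<notin> regs c" "fst \<sigma> r = Suc k"
    and c: "executes_at P inp (n + 2) c"
  shows "(instr_step P inp)\<^sup>*\<^sup>* (n, i, \<sigma>) (n, i, assign r k (exec c \<sigma>))"
proof -
  let ?R = "instr_step P inp"
  let ?m = "n + 2 + length (compile c (n + 2))"
  have JZ: "code_at P n [JZ r (Suc ?m)]" and DEC: "code_at P (n + 1) [DEC r]"
    and JMP: "code_at P ?m [JMP n]"
    using code by (auto simp: Let_def code_at_append)
  have "?R\<^sup>*\<^sup>* (n, i, \<sigma>) (n + 1, i, \<sigma>)"
    using r(2) by (intro r_into_rtranclp instr_stepI[OF JZ]) (cases \<sigma>, simp)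
  also have "?R \<dots> (n + 2, i, assign r k \<sigma>)"
    using r(2) by (intro instr_stepI[OF DEC]) (cases \<sigma>, simp)
  also have "?R\<^sup>*\<^sup>* \<dots> (?m, i, assign r k (exec c \<sigma>))"
    using executes_atD[OF c, of i "assign r k \<sigma>"] by (simp only: exec_assign[OF r(1)])
  also have "?R \<dots> (n, i, assign r k (exec c \<sigma>))"
    by (intro instr_stepI[OF JMP]) (cases "exec c \<sigma>", simp)
  finally show ?thesis .
qed

lemma executes_at_Loop:
  assumes code: "code_at P n (compile (Loop r c) n)" and r: "r \<notin> regs c"
    and c: "executes_at P inp (n + 2) c"
  shows "executes_at P inp n (Loop r c)"
proof -
  let ?R = "instr_step P inp"
  let ?exit = "n + 3 + length (compile c (n + 2))"
  have JZ: "code_at P n [JZ r ?exit]" using code by (simp add: Let_def)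
  have "?R\<^sup>*\<^sup>* (n, i, \<sigma>) (?exit, i, assign r 0 ((exec c ^^ k) \<sigma>))" if "fst \<sigma> r = k" for i k \<sigma>
    using that
  proof (induction k arbitrary: \<sigma>)
    case 0
    have "?R (n, i, \<sigma>) (?exit, i, \<sigma>)"
      using 0 by (intro instr_stepI[OF JZ]) (cases \<sigma>, simp)
    then show ?case using assign_triv[OF 0] by simp
  next
    case (Suc k)
    have "?R\<^sup>*\<^sup>* (n, i, \<sigma>) (n, i, assign r k (exec c \<sigma>))"
      using loop_round[OF code r Suc.prems c] .
    also have "?R\<^sup>*\<^sup>* \<dots> (?exit, i, assign r 0 ((exec c ^^ k) (assign r k (exec c \<sigma>))))"
      by (rule Suc.IH) (simp add: fst_assign)
    also have "(exec c ^^ k) (assign r k (exec c \<sigma>)) = assign r k ((exec c ^^ Suc k) \<sigma>)"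
      using funpow_exec_assign[OF r, of k k "exec c \<sigma>"] by (simp add: funpow_swap1)
    finally show ?case by (simp only: assign_assign)
  qed
  then have "?R\<^sup>*\<^sup>* (n, i, \<sigma>) (?exit, i, exec (Loop r c) \<sigma>)" for i \<sigma> by simp
  moreover have "n + length (compile (Loop r c) n) = ?exit" by (simp add: Let_def)
  ultimately show ?thesis unfolding executes_at_def by (simp only:) blast
qed

lemma executes_at_compile:
  "wf_com c \<Longrightarrow> code_at P n (compile c n) \<Longrightarrow> executes_at P inp n c"
proof (induction c arbitrary: n)
  case (Seq c d)
  then show ?case by (intro executes_at_Seq) (auto simp: code_at_append)
next
  case (Cond r c d)
  then show ?case by (intro executes_at_Cond) (auto simp: Let_def code_at_append)
next
  case (Loop r c)
  then show ?case by (intro executes_at_Loop) (auto simp: Let_def code_at_append)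
next
  case Skip
  show ?case by (simp add: executes_at_def)
qed (rule executes_at_single, rule compile.simps, simp_all)+

section \<open>Counter machines\<close>

text \<open>
  A counter is the position of the head on a tape that carries a single \<open>1\<close>, in cell \<open>0\<close>. Counting
  and testing for zero then take one step each; state \<open>0\<close> is used for writing the marks, and the
  program counter \<open>pc\<close> is kept as the state \<open>Suc pc\<close>.
\<close>

fun counts :: "nat \<Rightarrow> tape \<Rightarrow> bool" where
  "counts 0 (l, r) \<longleftrightarrow> l = [] \<and> first_sym r = 1 \<and> set (tl r) \<subseteq> {0}"
| "counts (Suc n) (l, r) \<longleftrightarrow> l = replicate n 0 @ [1] \<and> set r \<subseteq> {0}"

fun head_move :: "instr \<Rightarrow> nat \<Rightarrow> nat \<Rightarrow> move" where
  "head_move (INC r) j a = (if j = r then Right else Stay)"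
| "head_move (DEC r) j a = (if j = r \<and> a = 0 then Left else Stay)"
| "head_move _ j a = Stay"

fun next_pc :: "instr \<Rightarrow> nat \<Rightarrow> bool \<Rightarrow> nat list \<Rightarrow> nat" where
  "next_pc (JZ r p) pc x ws = (if ws ! r = 0 then Suc pc else p)"
| "next_pc (JMP p) pc x ws = p"
| "next_pc (READ p) pc x ws = (if x then Suc pc else p)"
| "next_pc _ pc x ws = Suc pc"

definition rule_of :: "instr \<Rightarrow> nat \<Rightarrow> bool \<Rightarrow> nat list \<Rightarrow> rule" where
  "rule_of ins pc x ws =
     \<lparr>r_state = Suc pc, r_input = x,
      r_work = map (\<lambda>j. (ws ! j, ws ! j, head_move ins j (ws ! j))) [0..<length ws],
      r_next = Suc (next_pc ins pc x ws),
      r_advance = (case ins of READ p \<Rightarrow> x | _ \<Rightarrow> False),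
      r_emit = (case ins of EMIT b \<Rightarrow> Some b | _ \<Rightarrow> None)\<rparr>"

definition mark_rule :: "nat \<Rightarrow> bool \<Rightarrow> rule" where
  "mark_rule k x = \<lparr>r_state = 0, r_input = x, r_work = replicate k (0, 1, Stay), r_next = 1,
     r_advance = False, r_emit = None\<rparr>"

definition machine_of :: "nat \<Rightarrow> instr list \<Rightarrow> machine" where
  "machine_of k P = \<lparr>n_tapes = k, rules = map (mark_rule k) [False, True] @
     [rule_of (P ! pc) pc x ws.
       pc \<leftarrow> [0..<length P], x \<leftarrow> [False, True], ws \<leftarrow> List.n_lists k [0, 1]]\<rparr>"

fun represents :: "nat \<Rightarrow> config \<Rightarrow> instr_state \<Rightarrow> bool" where
  "represents k c (pc, i, s, w) \<longleftrightarrow> state c = Suc pc \<and> pos c = i \<and> out c = w \<and>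
     length (tapes c) = k \<and> (\<forall>j<k. counts (s j) (tapes c ! j))"

lemma blank_cells:
  assumes "set r \<subseteq> {0::nat}"
  shows "first_sym r = 0" "set (tl r) \<subseteq> {0}"
  using assms by (cases r; simp)+

lemma scanned_counts: "counts n T \<Longrightarrow> scanned T = of_bool (n = 0)"
  by (cases "(n, T)" rule: counts.cases) (auto simp: blank_cells)

lemma counts_Stay: "counts n T \<Longrightarrow> counts n (tape_op (scanned T, scanned T, Stay) T)"
  by (cases "(n, T)" rule: counts.cases) (auto simp: blank_cells)

lemma counts_Right: "counts n T \<Longrightarrow> counts (Suc n) (tape_op (scanned T, scanned T, Right) T)"
  by (cases "(n, T)" rule: counts.cases) (auto simp: blank_cells)

lemma counts_Left: "counts (Suc n) T \<Longrightarrow> counts n (tape_op (scanned T, scanned T, Left) T)"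
  by (cases "(n, T)" rule: counts.cases; cases n) (auto simp: blank_cells)

lemma find_eq_SomeI:
  assumes "x \<in> set xs" "P x" "\<And>y. y \<in> set xs \<Longrightarrow> P y \<Longrightarrow> y = x"
  shows "find P xs = Some x"
proof (cases "find P xs")
  case None
  then show ?thesis using assms(1,2) by (simp add: find_None_iff)
next
  case (Some y)
  then have "y \<in> set xs" "P y" unfolding find_Some_iff by auto
  then show ?thesis using Some assms(3) by simp
qed

lemma set_rules_machine_of:
  "set (rules (machine_of k P)) = range (mark_rule k) \<union>
     {rule_of (P ! pc) pc x ws |pc x ws. pc < length P \<and> length ws = k \<and> set ws \<subseteq> {0, 1}}"
proof -
  have "range (mark_rule k) = {mark_rule k False, mark_rule k True}" by (auto simp: UNIV_bool)
  then show ?thesis by (auto simp: machine_of_def set_n_lists ex_bool_eq)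
qed

lemma applicable_mark_rule:
  "applicable inp c (mark_rule k x) \<longleftrightarrow>
     state c = 0 \<and> x = inp (pos c) \<and> map scanned (tapes c) = replicate k 0"
  by (auto simp: applicable_def mark_rule_def)

lemma applicable_rule_of:
  "applicable inp c (rule_of ins pc x ws) \<longleftrightarrow>
     state c = Suc pc \<and> x = inp (pos c) \<and> map scanned (tapes c) = ws"
  by (auto simp: applicable_def rule_of_def o_def map_nth)

lemma step_machine_of_init:
  fixes k P
  defines "c \<equiv> init (machine_of k P)"
  shows "step (machine_of k P) inp c = apply_rule (mark_rule k (inp 0)) c"
proof -
  have c: "state c = 0" "pos c = 0" "map scanned (tapes c) = replicate k 0"
    by (simp_all add: c_def init_def machine_of_def)
  then have "find (applicable inp c) (rules (machine_of k P)) = Some (mark_rule k (inp 0))"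
    by (intro find_eq_SomeI)
      (auto simp: set_rules_machine_of applicable_mark_rule applicable_rule_of)
  then show ?thesis by (simp add: step_def)
qed

lemma step_machine_of:
  assumes state: "state c = Suc pc" and pc: "pc < length P" and tapes: "length (tapes c) = k"
    and symbols: "set (map scanned (tapes c)) \<subseteq> {0, 1}"
  shows "step (machine_of k P) inp c =
    apply_rule (rule_of (P ! pc) pc (inp (pos c)) (map scanned (tapes c))) c"
    (is "_ = apply_rule ?\<rho> c")
proof -
  have "find (applicable inp c) (rules (machine_of k P)) = Some ?\<rho>"
  proof (rule find_eq_SomeI)
    have "length (map scanned (tapes c)) = k" using tapes by simp
    then show "?\<rho> \<in> set (rules (machine_of k P))"
      unfolding set_rules_machine_of using symbols pc by blast
  qed (use state in \<open>auto simp: set_rules_machine_of applicable_mark_rule applicable_rule_of\<close>)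
  then show ?thesis by (simp add: step_def)
qed

lemma represents_init:
  "represents k (step (machine_of k P) inp (init (machine_of k P))) (0, 0, (\<lambda>_. 0), [])"
  unfolding step_machine_of_init
  by (simp add: apply_rule_def mark_rule_def init_def machine_of_def)

lemma counts_head_move:
  assumes "counts (s j) T" and "exec_instr inp ins (pc, i, s, w) = (pc', i', s', w')"
  shows "counts (s' j) (tape_op (scanned T, scanned T, head_move ins j (scanned T)) T)"
proof -
  have "counts (s j - 1) (tape_op (scanned T, scanned T, Left) T)" if "s j > 0"
    using assms(1) that counts_Left[of "s j - 1" T] by simp
  then show ?thesis
    using assms scanned_counts[OF assms(1)] counts_Stay[OF assms(1)] counts_Right[OF assms(1)]
    by (cases ins) (auto split: if_splits)
qed

lemma next_pc_correct:
  assumes "exec_instr inp ins (pc, i, s, w) = (pc', i', s', w')"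
    and "\<And>r. r \<in> instr_regs ins \<Longrightarrow> ws ! r = of_bool (s r = 0)"
  shows "next_pc ins pc (inp i) ws = pc'"
  using assms by (cases ins) (auto split: if_splits)

lemma scanned_represents:
  "represents k c (pc, i, s, w) \<Longrightarrow> j < k \<Longrightarrow> scanned (tapes c ! j) = of_bool (s j = 0)"
  by (simp add: scanned_counts)

lemma set_scanned_represents:
  assumes "represents k c (pc, i, s, w)"
  shows "set (map scanned (tapes c)) \<subseteq> {0, 1}"
proof
  fix x assume "x \<in> set (map scanned (tapes c))"
  then obtain j where "j < k" "x = scanned (tapes c ! j)"
    using assms by (auto simp: in_set_conv_nth)
  then show "x \<in> {0, 1}" using scanned_represents[OF assms] by simp
qed

lemma represents_step:
  assumes "represents k c a" "instr_step P inp a b" "instr_regs (P ! fst a) \<subseteq> {..<k}"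
  shows "represents k (step (machine_of k P) inp c) b"
proof -
  obtain pc i s w where a: "a = (pc, i, s, w)" by (cases a)
  obtain pc' i' s' w' where b: "b = (pc', i', s', w')" by (cases b)
  have rep: "represents k c (pc, i, s, w)" using assms(1) by (simp only: a)
  then have state: "state c = Suc pc" and tapes: "length (tapes c) = k" and "pos c = i" "out c = w"
    and counts: "\<And>j. j < k \<Longrightarrow> counts (s j) (tapes c ! j)"
    by auto
  have pc: "pc < length P" and exec: "exec_instr inp (P ! pc) (pc, i, s, w) = (pc', i', s', w')"
    using assms(2) by (auto simp: a b instr_step_def)
  have "next_pc (P ! pc) pc (inp i) (map scanned (tapes c)) = pc'"
    using assms(3) tapes scanned_represents[OF rep]
    by (intro next_pc_correct[OF exec]) (auto simp: a)
  moreover have "i' = (if (case P ! pc of READ p \<Rightarrow> inp i | _ \<Rightarrow> False) then Suc i else i)"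
    and "w' = w @ (case (case P ! pc of EMIT b \<Rightarrow> Some b | _ \<Rightarrow> None) of
      None \<Rightarrow> [] | Some b \<Rightarrow> [b])"
    using exec by (cases "P ! pc"; auto split: if_splits)+
  ultimately show ?thesis
    unfolding b step_machine_of[OF state pc tapes set_scanned_represents[OF rep]]
    using \<open>pos c = i\<close> \<open>out c = w\<close> tapes counts_head_move[OF counts exec]
    by (simp add: rule_of_def apply_rule_def)
qed

lemma represents_funpow_step:
  assumes "represents k c a" "(instr_step P inp ^^ t) a b"
    and regs: "\<And>ins. ins \<in> set P \<Longrightarrow> instr_regs ins \<subseteq> {..<k}"
  shows "represents k ((step (machine_of k P) inp ^^ t) c) b"
  using assms(2)
proof (induction t arbitrary: b)
  case 0
  then show ?case using assms(1) by simp
next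
  case (Suc t)
  then obtain d where d: "(instr_step P inp ^^ t) a d" "instr_step P inp d b" by auto
  then have "P ! fst d \<in> set P" by (simp add: instr_step_def)
  then show ?case using represents_step[OF Suc.IH[OF d(1)] d(2)] regs by simp
qed

definition input_regs :: "nat \<Rightarrow> nat \<Rightarrow> nat" where
  "input_regs n r = (if r = 0 then n else 0)"

definition repeat_entry :: "com \<Rightarrow> nat" where
  "repeat_entry c = 3 + length (compile c 3)"

definition repeat_prog :: "com \<Rightarrow> com \<Rightarrow> instr list" where
  "repeat_prog c d = [READ 3, INC 0, JMP 0] @ compile c 3 @
     compile d (repeat_entry c) @ [JMP (repeat_entry c)]"

lemma
  shows code_at_repeat_read: "code_at (repeat_prog c d) 0 [READ 3, INC 0, JMP 0]"
    and code_at_repeat_start: "code_at (repeat_prog c d) 3 (compile c 3)"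
    and code_at_repeat_body:
      "code_at (repeat_prog c d) (repeat_entry c) (compile d (repeat_entry c))"
    and code_at_repeat_jump:
      "code_at (repeat_prog c d) (repeat_entry c + length (compile d (repeat_entry c)))
         [JMP (repeat_entry c)]"
  using code_at_whole[of "repeat_prog c d"]
  by (auto simp: repeat_prog_def repeat_entry_def code_at_append eval_nat_numeral)

lemma repeat_prog_read:
  "(instr_step (repeat_prog c d) (nat_input e))\<^sup>*\<^sup>* (0, 0, (\<lambda>_. 0), []) (3, e, input_regs e, [])"
proof -
  let ?R = "instr_step (repeat_prog c d) (nat_input e)"
  note code = code_at_repeat_read[of c d]
  have "?R\<^sup>*\<^sup>* (0, 0, (\<lambda>_. 0), []) (0, i, input_regs i, [])" if "i \<le> e" for i
    using that
  proof (induction i)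
    case 0
    then show ?case by (simp add: input_regs_def)
  next
    case (Suc i)
    then have "?R\<^sup>*\<^sup>* (0, 0, (\<lambda>_. 0), []) (0, i, input_regs i, [])" by simp
    also have "?R \<dots> (1, Suc i, input_regs i, [])"
      using Suc.prems code by (simp add: instr_step_def nat_input_def)
    also have "?R \<dots> (2, Suc i, input_regs (Suc i), [])"
      using code by (auto simp: instr_step_def eval_nat_numeral input_regs_def)
    also have "?R \<dots> (0, Suc i, input_regs (Suc i), [])"
      using code by (simp add: instr_step_def eval_nat_numeral)
    finally show ?case .
  qed
  then have "?R\<^sup>*\<^sup>* (0, 0, (\<lambda>_. 0), []) (0, e, input_regs e, [])" by simp
  also have "?R \<dots> (3, e, input_regs e, [])"
    using code by (simp add: instr_step_def nat_input_def)
  finally show ?thesis .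
qed

lemma repeat_prog_loop:
  fixes e :: nat
  assumes "wf_com c" "wf_com d"
  defines "\<sigma> n \<equiv> (exec d ^^ n) (exec c (input_regs e, []))"
  shows "\<exists>t\<ge>n. (instr_step (repeat_prog c d) (nat_input e) ^^ t)
    (0, 0, (\<lambda>_. 0), []) (repeat_entry c, e, \<sigma> n)"
proof (induction n)
  case 0
  let ?R = "instr_step (repeat_prog c d) (nat_input e)"
  note repeat_prog_read
  also have "?R\<^sup>*\<^sup>* (3, e, input_regs e, []) (repeat_entry c, e, \<sigma> 0)"
    using executes_atD[OF executes_at_compile[OF assms(1) code_at_repeat_start]]
    by (simp add: \<sigma>_def repeat_entry_def)
  finally show ?case by (auto dest: rtranclp_imp_relpowp)
next
  case (Suc n)
  let ?R = "instr_step (repeat_prog c d) (nat_input e)"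
  let ?end = "repeat_entry c + length (compile d (repeat_entry c))"
  obtain t where t: "t \<ge> n" "(?R ^^ t) (0, 0, (\<lambda>_. 0), []) (repeat_entry c, e, \<sigma> n)"
    using Suc.IH by blast
  have "?R\<^sup>*\<^sup>* (repeat_entry c, e, \<sigma> n) (?end, e, \<sigma> (Suc n))"
    using executes_atD[OF executes_at_compile[OF assms(2) code_at_repeat_body]] by (simp add: \<sigma>_def)
  then obtain u where u: "(?R ^^ u) (repeat_entry c, e, \<sigma> n) (?end, e, \<sigma> (Suc n))"
    using rtranclp_imp_relpowp by metis
  have "?R (?end, e, \<sigma> (Suc n)) (repeat_entry c, e, \<sigma> (Suc n))"
    by (intro instr_stepI[OF code_at_repeat_jump]) (cases "\<sigma> (Suc n)", simp)
  with t(2) u have "(?R ^^ Suc (t + u)) (0, 0, (\<lambda>_. 0), []) (repeat_entry c, e, \<sigma> (Suc n))"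
    by (auto simp: relpowp_add)
  moreover have "Suc n \<le> Suc (t + u)" using t(1) by simp
  ultimately show ?case by blast
qed

lemma finite_regs: "finite (regs c)"
  by (induction c) auto

theorem ex_machine_repeating:
  assumes "wf_com c" "wf_com d"
  shows "\<exists>M. \<forall>e n. \<exists>t\<ge>n.
    out (run M (nat_input e) t) = snd ((exec d ^^ n) (exec c (input_regs e, [])))"
proof -
  define P where "P = repeat_prog c d"
  obtain k where k: "insert 0 (regs c \<union> regs d) \<subseteq> {..<k}"
    using finite_nat_iff_bounded[of "insert 0 (regs c \<union> regs d)"] by (auto simp: finite_regs)
  have regs: "instr_regs ins \<subseteq> {..<k}" if "ins \<in> set P" for ins
    using that k instr_regs_compile[of ins] by (fastforce simp: P_def repeat_prog_def)
  define M where "M = machine_of k P"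
  have "\<exists>t\<ge>n. out (run M (nat_input e) t) = snd ((exec d ^^ n) (exec c (input_regs e, [])))" for e n
  proof -
    let ?\<sigma> = "(exec d ^^ n) (exec c (input_regs e, []))"
    obtain t where t: "t \<ge> n"
      "(instr_step P (nat_input e) ^^ t) (0, 0, (\<lambda>_. 0), []) (repeat_entry c, e, ?\<sigma>)"
      using repeat_prog_loop[OF assms] unfolding P_def by blast
    have "represents k ((step M (nat_input e) ^^ t) (step M (nat_input e) (init M)))
        (repeat_entry c, e, ?\<sigma>)"
      unfolding M_def by (rule represents_funpow_step[OF represents_init t(2) regs])
    then have "out (run M (nat_input e) (Suc t)) = snd ?\<sigma>"
      by (cases ?\<sigma>) (simp add: run_def funpow_swap1)
    then show ?thesis using t(1) by (intro exI[of _ "Suc t"]) simp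
  qed
  then show ?thesis by blast
qed

section \<open>Functions computed by loop programs\<close>

definition clear_com :: "nat \<Rightarrow> com" where
  "clear_com a = Loop a Skip"

definition move_com :: "nat \<Rightarrow> nat \<Rightarrow> com" where
  "move_com a b = Loop a (Inc b)"

definition move2_com :: "nat \<Rightarrow> nat \<Rightarrow> nat \<Rightarrow> com" where
  "move2_com a b d = Loop a (Inc b ;; Inc d)"

definition copy_com :: "nat \<Rightarrow> nat \<Rightarrow> nat \<Rightarrow> com" where
  "copy_com a b t = move2_com a b t ;; move_com t a"

lemma exec_clear_com: "exec (clear_com a) (s, w) = (s(a := 0), w)"
proof -
  have "(exec Skip ^^ n) (s, w) = (s, w)" for n by (induction n) simp_all
  then show ?thesis by (simp add: clear_com_def)
qed

lemma exec_move_com: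
  assumes "a \<noteq> b"
  shows "exec (move_com a b) (s, w) = (s(a := 0, b := s b + s a), w)"
proof -
  have "(exec (Inc b) ^^ n) (s, w) = (s(b := s b + n), w)" for n
    by (induction n) (auto simp: fun_eq_iff)
  then show ?thesis using assms by (auto simp: move_com_def fun_eq_iff)
qed

lemma exec_move2_com:
  assumes "distinct [a, b, d]"
  shows "exec (move2_com a b d) (s, w) = (s(a := 0, b := s b + s a, d := s d + s a), w)"
proof -
  have "(exec (Inc b ;; Inc d) ^^ n) (s, w) = (s(b := s b + n, d := s d + n), w)" for n
    using assms by (induction n) (auto simp: fun_eq_iff)
  then show ?thesis using assms by (auto simp: move2_com_def fun_eq_iff)
qed

lemma exec_copy_com:
  assumes "distinct [a, b, t]" "s t = 0"
  shows "exec (copy_com a b t) (s, w) = (s(b := s b + s a), w)"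
  using assms by (auto simp: copy_com_def exec_move_com exec_move2_com fun_eq_iff)

text \<open>Counting along the Cantor enumeration of pairs decodes a number without arithmetic.\<close>

definition pair_succ :: "nat \<times> nat \<Rightarrow> nat \<times> nat" where
  "pair_succ p = (if snd p = 0 then (0, Suc (fst p)) else (Suc (fst p), snd p - 1))"

lemma prod_decode_0: "prod_decode 0 = (0, 0)"
  by (simp add: prod_decode_def prod_decode_aux.simps)

lemma prod_decode_Suc: "prod_decode (Suc n) = pair_succ (prod_decode n)"
proof -
  have "prod_encode (pair_succ p) = Suc (prod_encode p)" for p
    by (cases p; cases "snd p") (auto simp: pair_succ_def prod_encode_def)
  from this[of "prod_decode n"] show ?thesis
    by (metis prod_encode_inverse prod_decode_inverse)
qed

definition pair_succ_com :: "nat \<Rightarrow> nat \<Rightarrow> com" where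
  "pair_succ_com a b = Cond b (Dec b ;; Inc a) (move_com a b ;; Inc b)"

definition prod_decode_com :: "nat \<Rightarrow> nat \<Rightarrow> nat \<Rightarrow> com" where
  "prod_decode_com r a b = Loop r (pair_succ_com a b)"

lemma exec_pair_succ_com:
  assumes "a \<noteq> b" "(s a, s b) = p"
  shows "exec (pair_succ_com a b) (s, w) = (s(a := fst (pair_succ p), b := snd (pair_succ p)), w)"
  using assms by (auto simp: pair_succ_com_def pair_succ_def exec_move_com fun_eq_iff)

lemma exec_prod_decode_com:
  assumes "distinct [a, b, r]" "s a = 0" "s b = 0"
  shows "exec (prod_decode_com r a b) (s, w) =
    (s(r := 0, a := fst (prod_decode (s r)), b := snd (prod_decode (s r))), w)"
proof -
  have "(exec (pair_succ_com a b) ^^ n) (s, w) =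
      (s(a := fst (prod_decode n), b := snd (prod_decode n)), w)" for n
  proof (induction n)
    case 0
    then show ?case using assms by (auto simp: prod_decode_0)
  next
    case (Suc n)
    then show ?case using assms(1)
      by (auto simp: exec_pair_succ_com[of _ _ _ "prod_decode n"] prod_decode_Suc fun_eq_iff)
  qed
  then show ?thesis using assms(1) by (auto simp: prod_decode_com_def fun_eq_iff)
qed

definition triangle_com :: "nat \<Rightarrow> nat \<Rightarrow> nat \<Rightarrow> nat \<Rightarrow> com" where
  "triangle_com b z i t = Loop b (Inc i ;; copy_com i z t) ;; clear_com i"

lemma exec_triangle_com:
  assumes "distinct [b, z, i, t]" "s i = 0" "s t = 0"
  shows "exec (triangle_com b z i t) (s, w) = (s(b := 0, z := s z + triangle (s b)), w)"
proof -
  have "(exec (Inc i ;; copy_com i z t) ^^ n) (s, w) = (s(i := n, z := s z + triangle n), w)" for n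
    using assms by (induction n) (auto simp: exec_copy_com fun_eq_iff)
  then show ?thesis
    using assms by (auto simp: triangle_com_def exec_clear_com fun_eq_iff)
qed

definition prod_encode_com :: "nat \<Rightarrow> nat \<Rightarrow> nat \<Rightarrow> nat \<Rightarrow> com" where
  "prod_encode_com a b z i = move2_com a b z ;; triangle_com b z i a ;; move_com z b"

lemma exec_prod_encode_com:
  assumes "distinct [a, b, z, i]" "s z = 0" "s i = 0"
  shows "exec (prod_encode_com a b z i) (s, w) = (s(a := 0, b := prod_encode (s a, s b)), w)"
proof -
  have "exec (move2_com a b z) (s, w) = (s(a := 0, b := s b + s a, z := s a), w)"
    using assms by (simp add: exec_move2_com)
  moreover have "exec (triangle_com b z i a) (s(a := 0, b := s b + s a, z := s a), w) =
      (s(a := 0, b := 0, z := s a + triangle (s b + s a)), w)"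
    using assms by (subst exec_triangle_com) (auto simp: fun_eq_iff)
  moreover have "exec (move_com z b) (s(a := 0, b := 0, z := s a + triangle (s b + s a)), w) =
      (s(a := 0, b := prod_encode (s a, s b)), w)"
    using assms by (auto simp: exec_move_com prod_encode_def fun_eq_iff add.commute)
  ultimately show ?thesis by (simp add: prod_encode_com_def)
qed

lemmas com_defs = clear_com_def move_com_def move2_com_def copy_com_def pair_succ_com_def
  prod_decode_com_def triangle_com_def prod_encode_com_def

text \<open>
  Scratch registers are zero before and after, and registers above \<open>N\<close> are untouched, so that
  programs can be combined without renaming registers.
\<close>

definition implements :: "com \<Rightarrow> nat \<Rightarrow> (nat \<Rightarrow> nat) \<Rightarrow> bool" where
  "implements c N f \<longleftrightarrow> wf_com c \<and> regs c \<subseteq> {..N} \<and>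
     (\<forall>s w. (\<forall>r. 0 < r \<longrightarrow> r \<le> N \<longrightarrow> s r = 0) \<longrightarrow> exec c (s, w) = (s(0 := f (s 0)), w))"

definition implementable :: "(nat \<Rightarrow> nat) \<Rightarrow> bool" where
  "implementable f \<longleftrightarrow> (\<exists>c N. implements c N f)"

lemma implementableI:
  assumes "wf_com c" "regs c \<subseteq> {..N}"
    "\<And>s w. (\<And>r. 0 < r \<Longrightarrow> r \<le> N \<Longrightarrow> s r = 0) \<Longrightarrow> exec c (s, w) = (s(0 := f (s 0)), w)"
  shows "implementable f"
  unfolding implementable_def implements_def using assms by (intro exI[of _ c] exI[of _ N]) auto

lemma
  assumes "implements c N f"
  shows implements_wf_com: "wf_com c"
    and implements_regs_le: "r \<in> regs c \<Longrightarrow> r \<le> N"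
    and exec_implements:
      "(\<And>r. 0 < r \<Longrightarrow> r \<le> N \<Longrightarrow> s r = 0) \<Longrightarrow> exec c (s, w) = (s(0 := f (s 0)), w)"
  using assms by (auto simp: implements_def)

lemma implementable_Suc: "implementable Suc"
  by (rule implementableI[of "Inc 0" 0]) auto

lemma implementable_zero: "implementable (\<lambda>x. 0)"
  by (rule implementableI[of "clear_com 0" 0])
    (simp_all add: exec_clear_com, simp_all add: clear_com_def)

lemma implementable_id: "implementable (\<lambda>x. x)"
  by (rule implementableI[of Skip 0]) auto

lemma implementable_comp:
  assumes "implementable f" "implementable g"
  shows "implementable (\<lambda>x. f (g x))"
proof -
  obtain c N where c: "implements c N f"
    using assms(1) unfolding implementable_def by blast
  obtain d L where d: "implements d L g"
    using assms(2) unfolding implementable_def by blast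
  show ?thesis
  proof (rule implementableI[of "d ;; c" "max N L"])
    show "wf_com (d ;; c)" using c d by (simp add: implements_wf_com)
    show "regs (d ;; c) \<subseteq> {..max N L}"
      using implements_regs_le[OF c] implements_regs_le[OF d] by (auto simp: le_max_iff_disj)
  qed (simp add: exec_implements[OF c] exec_implements[OF d])
qed

lemma implementable_const: "implementable (\<lambda>x. n)"
  by (induction n) (auto intro: implementable_zero implementable_comp[OF implementable_Suc])

lemma implementable_fst: "implementable (\<lambda>x. fst (prod_decode x))"
  by (rule implementableI[of "prod_decode_com 0 1 2 ;; move_com 1 0 ;; clear_com 2" 2])
    (auto simp: exec_prod_decode_com exec_move_com exec_clear_com fun_eq_iff, auto simp: com_defs)

lemma implementable_snd: "implementable (\<lambda>x. snd (prod_decode x))"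
  by (rule implementableI[of "prod_decode_com 0 1 2 ;; move_com 2 0 ;; clear_com 1" 2])
    (auto simp: exec_prod_decode_com exec_move_com exec_clear_com fun_eq_iff, auto simp: com_defs)

lemma implementable_pair:
  assumes "implementable f" "implementable g"
  shows "implementable (\<lambda>x. prod_encode (f x, g x))"
proof -
  obtain c N where c: "implements c N f"
    using assms(1) unfolding implementable_def by blast
  obtain d L where d: "implements d L g"
    using assms(2) unfolding implementable_def by blast
  define m where "m = Suc (max N L)"
  have m: "N < m" "L < m" "0 < m" by (auto simp: m_def)
  let ?p = "copy_com 0 m (m + 1) ;; c ;; move_com 0 (m + 1) ;; move_com m 0 ;; d ;;
    prod_encode_com (m + 1) 0 m (m + 2)"
  show ?thesis
  proof (rule implementableI[of ?p "m + 2"])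
    show "wf_com ?p"
      using implements_wf_com[OF c] implements_wf_com[OF d] m by (auto simp: com_defs)
    show "regs ?p \<subseteq> {..m + 2}"
      using m by (auto simp: com_defs dest!: implements_regs_le[OF c] implements_regs_le[OF d])
  next
    fix s :: "nat \<Rightarrow> nat" and w
    assume s: "\<And>r. 0 < r \<Longrightarrow> r \<le> m + 2 \<Longrightarrow> s r = 0"
    then have scratch: "s m = 0" "s (m + 1) = 0" "s (m + 2) = 0" using m by simp_all
    have "exec (copy_com 0 m (m + 1)) (s, w) = (s(m := s 0), w)"
      using m scratch by (simp add: exec_copy_com)
    moreover have "exec c (s(m := s 0), w) = (s(m := s 0, 0 := f (s 0)), w)"
      using exec_implements[OF c, of "s(m := s 0)"] m s by auto
    moreover have "exec (move_com 0 (m + 1) ;; move_com m 0) (s(m := s 0, 0 := f (s 0)), w) =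
        (s(m + 1 := f (s 0)), w)"
      using m scratch by (auto simp: exec_move_com fun_eq_iff)
    moreover have "exec d (s(m + 1 := f (s 0)), w) = (s(m + 1 := f (s 0), 0 := g (s 0)), w)"
      using exec_implements[OF d, of "s(m + 1 := f (s 0))"] m s by auto
    moreover have "exec (prod_encode_com (m + 1) 0 m (m + 2))
        (s(m + 1 := f (s 0), 0 := g (s 0)), w) = (s(0 := prod_encode (f (s 0), g (s 0))), w)"
      using m scratch by (subst exec_prod_encode_com) (auto simp: fun_eq_iff)
    ultimately show "exec ?p (s, w) = (s(0 := prod_encode (f (s 0), g (s 0))), w)"
      by simp
  qed
qed

lemma implementable_iterate:
  assumes "implementable f"
  shows "implementable (\<lambda>x. (f ^^ snd (prod_decode x)) (fst (prod_decode x)))"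
proof -
  obtain c N where c: "implements c N f"
    using assms unfolding implementable_def by blast
  define m where "m = Suc N"
  have m: "N < m" "0 < m" by (auto simp: m_def)
  let ?p = "prod_decode_com 0 m (m + 1) ;; move_com m 0 ;; Loop (m + 1) c"
  show ?thesis
  proof (rule implementableI[of ?p "m + 1"])
    show "wf_com ?p"
      using implements_wf_com[OF c] m by (auto simp: com_defs dest: implements_regs_le[OF c])
    show "regs ?p \<subseteq> {..m + 1}"
      using m by (auto simp: com_defs dest!: implements_regs_le[OF c])
  next
    fix s :: "nat \<Rightarrow> nat" and w
    assume s: "\<And>r. 0 < r \<Longrightarrow> r \<le> m + 1 \<Longrightarrow> s r = 0"
    let ?x = "fst (prod_decode (s 0))" and ?n = "snd (prod_decode (s 0))"
    have "exec (prod_decode_com 0 m (m + 1) ;; move_com m 0) (s, w) = (s(0 := ?x, m + 1 := ?n), w)"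
      using m s by (auto simp: exec_prod_decode_com exec_move_com fun_eq_iff)
    moreover have "(exec c ^^ n) (s(0 := ?x, m + 1 := ?n), w) =
        (s(0 := (f ^^ n) ?x, m + 1 := ?n), w)" for n
      using m s by (induction n) (auto simp: exec_implements[OF c] fun_eq_iff)
    ultimately show "exec ?p (s, w) = (s(0 := (f ^^ ?n) ?x), w)"
      using m s by (auto simp: fun_eq_iff)
  qed
qed

section \<open>Enumeration by machines\<close>

lemma run_halted:
  assumes "halted M inp (run M inp t)"
  shows "run M inp (t + d) = run M inp t"
proof (induction d)
  case (Suc d)
  then show ?case using assms by (simp add: run_def step_def halted_def)
qed simp

lemma out_run_mono:
  assumes "t \<le> t'"
  shows "\<exists>v. out (run M inp t') = out (run M inp t) @ v"
  using assms
proof (induction t' rule: dec_induct)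
  case (step u)
  have "\<exists>v. out (step M inp c) = out c @ v" for c
    by (auto simp: step_def apply_rule_def split: option.splits)
  from this[of "run M inp u"] step.IH show ?case by (auto simp: run_def)
qed simp

lemma set_blocks_append: "set (blocks n u) \<subseteq> set (blocks n (u @ v))"
  by (induction n u rule: blocks.induct) auto

lemma enumerates_eq_UN:
  assumes "\<And>n. \<exists>t\<ge>n. out (run M inp t) = W n"
  shows "enumerates M inp = (\<Union>n. set (blocks 0 (W n)))"
proof (intro equalityI subsetI)
  fix c assume "c \<in> enumerates M inp"
  then obtain t where c: "c \<in> set (blocks 0 (out (run M inp t)))"
    by (auto simp: enumerates_def)
  obtain t' where "t \<le> t'" and t': "out (run M inp t') = W t"
    using assms by blast
  then obtain v where "W t = out (run M inp t) @ v"
    using out_run_mono by metis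
  then have "c \<in> set (blocks 0 (W t))" using c set_blocks_append by auto
  then show "c \<in> (\<Union>n. set (blocks 0 (W n)))" by blast
next
  fix c assume "c \<in> (\<Union>n. set (blocks 0 (W n)))"
  then obtain n where c: "c \<in> set (blocks 0 (W n))" by blast
  obtain t where "out (run M inp t) = W n" using assms by blast
  then show "c \<in> enumerates M inp" using c unfolding enumerates_def by (metis UN_I UNIV_I)
qed

text \<open>The argument encodes an optional number: \<open>0\<close> stands for \<open>None\<close>, and \<open>Suc c\<close> for \<open>Some c\<close>.\<close>

fun block :: "nat \<Rightarrow> bool list" where
  "block 0 = []"
| "block (Suc c) = replicate c True @ [False]"

lemma blocks_replicate: "blocks n (replicate c True @ False # w) = (n + c) # blocks 0 w"
  by (induction c arbitrary: n) auto

lemma set_blocks_concat_block: "set (blocks 0 (concat (map block xs))) = {c. Suc c \<in> set xs}"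
proof (induction xs)
  case (Cons x xs)
  then show ?case by (cases x) (auto simp: blocks_replicate)
qed simp

definition emit_block_com :: "nat \<Rightarrow> com" where
  "emit_block_com a = Cond a (Dec a ;; Loop a (Emit True) ;; Emit False) Skip"

lemma exec_emit_block_com: "exec (emit_block_com a) (s, w) = (s(a := 0), w @ block (s a))"
proof -
  have "(exec (Emit True) ^^ n) (s, w) = (s, w @ replicate n True)" for n s w
    by (induction n) (simp_all add: replicate_append_same[symmetric])
  then show ?thesis by (cases "s a") (auto simp: emit_block_com_def fun_eq_iff)
qed

definition transition_com :: "com \<Rightarrow> nat \<Rightarrow> com" where
  "transition_com c N =
     c ;; prod_decode_com 0 (N + 1) (N + 2) ;; move_com (N + 1) 0 ;; emit_block_com (N + 2)"

lemma exec_transition_com: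
  assumes "implements c N (\<lambda>q. prod_encode (f q, g q))"
  shows "exec (transition_com c N) (input_regs q, w) = (input_regs (f q), w @ block (g q))"
proof -
  have "exec c (input_regs q, w) = (input_regs (prod_encode (f q, g q)), w)"
    by (subst exec_implements[OF assms]) (auto simp: input_regs_def)
  moreover have "exec (prod_decode_com 0 (N + 1) (N + 2)) (input_regs (prod_encode (f q, g q)), w) =
      ((input_regs 0)(N + 1 := f q, N + 2 := g q), w)"
    by (subst exec_prod_decode_com) (auto simp: input_regs_def)
  moreover have "exec (move_com (N + 1) 0) ((input_regs 0)(N + 1 := f q, N + 2 := g q), w) =
      ((input_regs (f q))(N + 2 := g q), w)"
    by (subst exec_move_com) (auto simp: input_regs_def)
  moreover have "(input_regs (f q))(N + 2 := 0) = input_regs (f q)"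
    by (auto simp: input_regs_def)
  ultimately show ?thesis
    by (simp add: transition_com_def exec_emit_block_com fun_upd_same del: fun_upd_apply)
qed

theorem ex_machine_enumerating_orbit:
  assumes "implementable f" "implementable g" "implementable h"
  shows "\<exists>M. \<forall>e. enumerates M (nat_input e) = {c. \<exists>n. g ((f ^^ n) (h e)) = Suc c}"
proof -
  obtain c N where c: "implements c N (\<lambda>q. prod_encode (f q, g q))"
    using implementable_pair[OF assms(1,2)] unfolding implementable_def by blast
  obtain d L where d: "implements d L h" using assms(3) unfolding implementable_def by blast
  have "wf_com (transition_com c N)"
    using implements_wf_com[OF c] by (auto simp: transition_com_def com_defs emit_block_com_def)
  then obtain M where M: "\<And>e n. \<exists>t\<ge>n. out (run M (nat_input e) t) =
      snd ((exec (transition_com c N) ^^ n) (exec d (input_regs e, [])))"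
    using ex_machine_repeating[OF implements_wf_com[OF d]] by blast
  have "enumerates M (nat_input e) = {c. \<exists>n. g ((f ^^ n) (h e)) = Suc c}" for e
  proof -
    let ?gs = "\<lambda>n. map (\<lambda>i. g ((f ^^ i) (h e))) [0..<n]"
    have "exec d (input_regs e, []) = (input_regs (h e), [])"
      by (subst exec_implements[OF d]) (auto simp: input_regs_def)
    then have "(exec (transition_com c N) ^^ n) (exec d (input_regs e, [])) =
        (input_regs ((f ^^ n) (h e)), concat (map block (?gs n)))" for n
      by (induction n) (simp_all add: exec_transition_com[OF c])
    then have "\<exists>t\<ge>n. out (run M (nat_input e) t) = concat (map block (?gs n))" for n
      using M[where e = e and n = n] by simp
    then have "enumerates M (nat_input e) = (\<Union>n. {c. Suc c \<in> set (?gs n)})"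
      unfolding set_blocks_concat_block[symmetric] by (rule enumerates_eq_UN)
    also have "\<dots> = {c. \<exists>n. \<exists>i<n. g ((f ^^ i) (h e)) = Suc c}"
      by (simp add: UNION_eq image_iff Bex_def eq_commute)
    also have "\<dots> = {c. \<exists>n. g ((f ^^ n) (h e)) = Suc c}" by blast
    finally show ?thesis .
  qed
  then show ?thesis by blast
qed

section \<open>Computability on encoded types\<close>

class enc =
  fixes enc :: "'a \<Rightarrow> nat"
  assumes inj_enc: "inj enc"

lemma enc_eq_iff: "enc x = enc y \<longleftrightarrow> x = y"
  using inj_enc by (rule inj_eq)

instantiation nat :: enc
begin
definition enc_nat :: "nat \<Rightarrow> nat" where "enc_nat n = n"
instance by standard (simp add: enc_nat_def inj_def)
end

instantiation bool :: enc
begin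
definition enc_bool :: "bool \<Rightarrow> nat" where "enc_bool b = of_bool b"
instance by standard (simp add: enc_bool_def inj_def)
end

instantiation unit :: enc
begin
definition enc_unit :: "unit \<Rightarrow> nat" where "enc_unit x = 0"
instance by standard (simp add: inj_def)
end

instantiation prod :: (enc, enc) enc
begin
definition enc_prod :: "'a \<times> 'b \<Rightarrow> nat" where
  "enc_prod p = prod_encode (enc (fst p), enc (snd p))"
instance by standard (simp add: enc_prod_def inj_def prod_eq_iff enc_eq_iff)
end

instantiation option :: (enc) enc
begin
definition enc_option :: "'a option \<Rightarrow> nat" where
  "enc_option x = (case x of None \<Rightarrow> 0 | Some y \<Rightarrow> Suc (enc y))"
instance by standard (auto simp: enc_option_def inj_def enc_eq_iff split: option.splits)
end

instantiation list :: (enc) enc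
begin
definition enc_list :: "'a list \<Rightarrow> nat" where
  "enc_list xs = list_encode (map enc xs)"
instance
  by standard (simp add: enc_list_def inj_def list_encode_eq inj_map_eq_map[OF inj_enc])
end

instantiation move :: enc
begin
definition enc_move :: "move \<Rightarrow> nat" where
  "enc_move d = (case d of Stay \<Rightarrow> 0 | Left \<Rightarrow> 1 | Right \<Rightarrow> 2)"
instance by standard (auto simp: enc_move_def inj_def split: move.splits)
end

instantiation rule_ext :: (enc) enc
begin
definition enc_rule_ext :: "'a rule_scheme \<Rightarrow> nat" where
  "enc_rule_ext r =
     enc (r_state r, r_input r, r_work r, r_next r, r_advance r, r_emit r, rule.more r)"
instance by standard (simp add: enc_rule_ext_def inj_def enc_eq_iff)
end

instantiation config_ext :: (enc) enc
begin
definition enc_config_ext :: "'a config_scheme \<Rightarrow> nat" where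
  "enc_config_ext c = enc (state c, pos c, tapes c, out c, config.more c)"
instance by standard (simp add: enc_config_ext_def inj_def enc_eq_iff)
end

definition loop_computable :: "('a::enc \<Rightarrow> 'b::enc) \<Rightarrow> bool" where
  "loop_computable f \<longleftrightarrow> (\<exists>g. implementable g \<and> (\<forall>x. g (enc x) = enc (f x)))"

named_theorems loop_computable_intros

lemma loop_computableI: "implementable g \<Longrightarrow> (\<And>x. g (enc x) = enc (f x)) \<Longrightarrow> loop_computable f"
  by (auto simp: loop_computable_def)

lemma loop_computableE:
  assumes "loop_computable f"
  obtains g where "implementable g" "\<And>x. g (enc x) = enc (f x)"
  using assms by (auto simp: loop_computable_def)

lemma loop_computable_nat_iff: "loop_computable (f :: nat \<Rightarrow> nat) \<longleftrightarrow> implementable f"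
proof -
  have "g = f" if "\<forall>x. g x = f x" for g using that by auto
  then show ?thesis by (auto simp: loop_computable_def enc_nat_def)
qed

lemma loop_computable_if_enc_eq:
  assumes "\<And>x. enc (f x) = enc x"
  shows "loop_computable f"
  using assms by (intro loop_computableI[OF implementable_id]) simp

lemma loop_computable_id [loop_computable_intros]: "loop_computable (\<lambda>x. x)"
  by (rule loop_computable_if_enc_eq) simp

lemma loop_computable_const [loop_computable_intros]: "loop_computable (\<lambda>x. c)"
  by (rule loop_computableI[OF implementable_const]) simp

lemma loop_computable_comp:
  assumes "loop_computable f" "loop_computable g"
  shows "loop_computable (\<lambda>x. f (g x))"
proof -
  obtain f' where f': "implementable f'" "\<And>x. f' (enc x) = enc (f x)"
    using assms(1) by (rule loop_computableE) blast
  obtain g' where g': "implementable g'" "\<And>x. g' (enc x) = enc (g x)"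
    using assms(2) by (rule loop_computableE) blast
  show ?thesis
    by (rule loop_computableI[OF implementable_comp[OF f'(1) g'(1)]]) (simp add: f'(2) g'(2))
qed

lemma loop_computable_Pair [loop_computable_intros]:
  assumes "loop_computable f" "loop_computable g"
  shows "loop_computable (\<lambda>x. (f x, g x))"
proof -
  obtain f' where f': "implementable f'" "\<And>x. f' (enc x) = enc (f x)"
    using assms(1) by (rule loop_computableE) blast
  obtain g' where g': "implementable g'" "\<And>x. g' (enc x) = enc (g x)"
    using assms(2) by (rule loop_computableE) blast
  show ?thesis
    by (rule loop_computableI[OF implementable_pair[OF f'(1) g'(1)]])
      (simp add: f'(2) g'(2) enc_prod_def)
qed

lemma loop_computable_comp2:
  assumes "loop_computable (\<lambda>p. h (fst p) (snd p))" "loop_computable f" "loop_computable g"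
  shows "loop_computable (\<lambda>x. h (f x) (g x))"
  using loop_computable_comp[OF assms(1) loop_computable_Pair[OF assms(2,3)]] by simp

lemma loop_computable_fst [loop_computable_intros]:
  "loop_computable f \<Longrightarrow> loop_computable (\<lambda>x. fst (f x))"
  by (rule loop_computable_comp[of fst], rule loop_computableI[OF implementable_fst])
    (simp_all add: enc_prod_def)

lemma loop_computable_snd [loop_computable_intros]:
  "loop_computable f \<Longrightarrow> loop_computable (\<lambda>x. snd (f x))"
  by (rule loop_computable_comp[of snd], rule loop_computableI[OF implementable_snd])
    (simp_all add: enc_prod_def)

lemma loop_computable_case_prod [loop_computable_intros]:
  "loop_computable (\<lambda>x. f x (fst (p x)) (snd (p x))) \<Longrightarrow>
   loop_computable (\<lambda>x. case p x of (a, b) \<Rightarrow> f x a b)"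
  by (simp add: case_prod_beta)

lemma loop_computable_Let [loop_computable_intros]:
  "loop_computable (\<lambda>x. f x (a x)) \<Longrightarrow> loop_computable (\<lambda>x. let y = a x in f x y)"
  by simp

lemma loop_computable_enc [loop_computable_intros]:
  "loop_computable f \<Longrightarrow> loop_computable (\<lambda>x. enc (f x))"
  by (rule loop_computable_comp[of enc], rule loop_computable_if_enc_eq) (simp_all add: enc_nat_def)

lemma loop_computable_prod_decode [loop_computable_intros]:
  "loop_computable f \<Longrightarrow> loop_computable (\<lambda>x. prod_decode (f x))"
  by (rule loop_computable_comp[of prod_decode], rule loop_computable_if_enc_eq)
    (simp_all add: enc_prod_def enc_nat_def)

lemma loop_computable_list_decode [loop_computable_intros]:
  "loop_computable f \<Longrightarrow> loop_computable (\<lambda>x. list_decode (f x))"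
  by (rule loop_computable_comp[of list_decode], rule loop_computable_if_enc_eq)
    (simp_all add: enc_list_def enc_nat_def[abs_def])

lemma loop_computable_Suc [loop_computable_intros]:
  "loop_computable f \<Longrightarrow> loop_computable (\<lambda>x. Suc (f x))"
  by (rule loop_computable_comp[of Suc]) (simp_all add: loop_computable_nat_iff implementable_Suc)

lemma loop_computable_funpow [loop_computable_intros]:
  fixes g :: "'a::enc \<Rightarrow> 'b::enc \<Rightarrow> 'b"
  assumes "loop_computable (\<lambda>p. g (fst p) (snd p))" "loop_computable n" "loop_computable a"
  shows "loop_computable (\<lambda>x. (g x ^^ n x) (a x))"
proof -
  have "loop_computable (\<lambda>p. (fst p, g (fst p) (snd p)))"
    by (intro loop_computable_intros assms)
  then obtain h where h: "implementable h" "\<And>p. h (enc p) = enc (fst p, g (fst p) (snd p))"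
    by (rule loop_computableE) blast
  have "(h ^^ k) (enc (x, b)) = enc (x, (g x ^^ k) b)" for k x b
    by (induction k) (simp_all add: h(2))
  then have "loop_computable (\<lambda>q. (fst (fst q), (g (fst (fst q)) ^^ snd q) (snd (fst q))))"
    by (intro loop_computableI[OF implementable_iterate[OF h(1)]])
      (simp add: enc_prod_def enc_nat_def)
  moreover have "loop_computable (\<lambda>x. ((x, a x), n x))"
    by (intro loop_computable_intros assms)
  ultimately have "loop_computable (\<lambda>x. (x, (g x ^^ n x) (a x)))"
    by (auto dest: loop_computable_comp)
  then show ?thesis by (auto dest: loop_computable_snd)
qed

lemma loop_computable_if [loop_computable_intros]:
  assumes "loop_computable b" "loop_computable f" "loop_computable g"
  shows "loop_computable (\<lambda>x. if b x then f x else g x)"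
proof -
  have "loop_computable (\<lambda>x. ((\<lambda>_. f x) ^^ enc (b x)) (g x))"
    by (intro loop_computable_intros assms loop_computable_comp[OF assms(2)])
  also have "(\<lambda>x. ((\<lambda>_. f x) ^^ enc (b x)) (g x)) = (\<lambda>x. if b x then f x else g x)"
    by (auto simp: enc_bool_def)
  finally show ?thesis .
qed

lemma loop_computable_eq_0 [loop_computable_intros]:
  assumes "loop_computable f"
  shows "loop_computable (\<lambda>x. f x = (0 :: nat))"
proof -
  have "loop_computable (\<lambda>x. ((\<lambda>_. False) ^^ f x) True)"
    by (intro loop_computable_intros assms)
  moreover have "((\<lambda>_. False) ^^ n) True \<longleftrightarrow> n = 0" for n :: nat
    by (cases n) auto
  ultimately show ?thesis by simp
qed

lemma loop_computable_pred [loop_computable_intros]: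
  assumes "loop_computable f"
  shows "loop_computable (\<lambda>x. f x - (1 :: nat))"
proof -
  have "loop_computable (\<lambda>x. fst (((\<lambda>p :: nat \<times> nat. (snd p, Suc (snd p))) ^^ f x) (0, 0)))"
    by (intro loop_computable_intros assms)
  moreover have "((\<lambda>p :: nat \<times> nat. (snd p, Suc (snd p))) ^^ n) (0, 0) = (n - 1, n)" for n
    by (induction n) auto
  ultimately show ?thesis by simp
qed

lemma loop_computable_add [loop_computable_intros]:
  assumes "loop_computable f" "loop_computable g"
  shows "loop_computable (\<lambda>x. f x + g x :: nat)"
proof -
  have "loop_computable (\<lambda>x. (Suc ^^ g x) (f x))"
    by (intro loop_computable_intros assms)
  then show ?thesis by (simp add: add.commute)
qed

lemma loop_computable_diff [loop_computable_intros]: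
  assumes "loop_computable f" "loop_computable g"
  shows "loop_computable (\<lambda>x. f x - g x :: nat)"
proof -
  have "loop_computable (\<lambda>x. ((\<lambda>m. m - 1) ^^ g x) (f x))"
    by (intro loop_computable_intros assms)
  moreover have "((\<lambda>m. m - 1) ^^ n) m = m - n" for m n :: nat
    by (induction n) auto
  ultimately show ?thesis by simp
qed

lemma loop_computable_less [loop_computable_intros]:
  assumes "loop_computable f" "loop_computable g"
  shows "loop_computable (\<lambda>x. f x < (g x :: nat))"
proof -
  have "loop_computable (\<lambda>x. Suc (f x) - g x = 0)"
    by (intro loop_computable_intros assms)
  then show ?thesis by (simp add: Suc_le_eq)
qed

lemma loop_computable_eq [loop_computable_intros]:
  assumes "loop_computable f" "loop_computable g"
  shows "loop_computable (\<lambda>x. f x = g x)"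
proof -
  have "loop_computable (\<lambda>x. (enc (f x) - enc (g x)) + (enc (g x) - enc (f x)) = 0)"
    by (intro loop_computable_intros assms)
  moreover have "(m - n) + (n - m) = 0 \<longleftrightarrow> m = n" for m n :: nat
    by auto
  ultimately show ?thesis by (simp only: enc_eq_iff)
qed

lemma loop_computable_not [loop_computable_intros]:
  assumes "loop_computable P"
  shows "loop_computable (\<lambda>x. \<not> P x)"
proof -
  have "loop_computable (\<lambda>x. if P x then False else True)"
    by (intro loop_computable_intros assms)
  moreover have "(if P x then False else True) = (\<not> P x)" for x by simp
  ultimately show ?thesis by (simp only:)
qed

lemma loop_computable_conj [loop_computable_intros]:
  assumes "loop_computable P" "loop_computable Q"
  shows "loop_computable (\<lambda>x. P x \<and> Q x)"
proof -
  have "loop_computable (\<lambda>x. if P x then Q x else False)"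
    by (intro loop_computable_intros assms)
  moreover have "(if P x then Q x else False) = (P x \<and> Q x)" for x by simp
  ultimately show ?thesis by (simp only:)
qed

lemma loop_computable_disj [loop_computable_intros]:
  assumes "loop_computable P" "loop_computable Q"
  shows "loop_computable (\<lambda>x. P x \<or> Q x)"
proof -
  have "loop_computable (\<lambda>x. if P x then True else Q x)"
    by (intro loop_computable_intros assms)
  moreover have "(if P x then True else Q x) = (P x \<or> Q x)" for x by simp
  ultimately show ?thesis by (simp only:)
qed

text \<open>
  Case distinction on a type such as \<^typ>\<open>'a option\<close> or \<^typ>\<open>'a list\<close>, where one constructor is
  encoded as \<open>0\<close> and the other one as the successor of its encoded argument \<open>y\<close>.
\<close>

lemma loop_computable_case_enc:
  assumes "loop_computable f" "loop_computable a" "loop_computable b"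
    and cases: "\<And>x. enc (f x) = 0 \<and> h x = a x \<or> (\<exists>y. enc (f x) = Suc (enc y) \<and> h x = b (x, y))"
  shows "loop_computable h"
proof -
  obtain f' where f': "implementable f'" "\<And>x. f' (enc x) = enc (f x)"
    using assms(1) by (rule loop_computableE) blast
  obtain a' where a': "implementable a'" "\<And>x. a' (enc x) = enc (a x)"
    using assms(2) by (rule loop_computableE) blast
  obtain b' where b': "implementable b'" "\<And>p. b' (enc p) = enc (b p)"
    using assms(3) by (rule loop_computableE) blast
  have "implementable (\<lambda>n. f' n - 1)"
    using f'(1) unfolding loop_computable_nat_iff[symmetric] by (rule loop_computable_pred)
  then have "implementable (\<lambda>n. b' (prod_encode (n, f' n - 1)))"
    by (intro implementable_comp[OF b'(1)] implementable_pair implementable_id)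
  with f'(1) a'(1)
  have "implementable (\<lambda>n. if f' n = 0 then a' n else b' (prod_encode (n, f' n - 1)))"
    unfolding loop_computable_nat_iff[symmetric] by (intro loop_computable_intros)
  moreover have "(if f' (enc x) = 0 then a' (enc x) else b' (prod_encode (enc x, f' (enc x) - 1))) =
      enc (h x)" for x
    using cases[of x]
  proof
    assume "\<exists>y. enc (f x) = Suc (enc y) \<and> h x = b (x, y)"
    then obtain y where "enc (f x) = Suc (enc y)" "h x = b (x, y)" by blast
    then show ?thesis using b'(2)[of "(x, y)"] by (simp add: f'(2) enc_prod_def)
  qed (simp add: f'(2) a'(2))
  ultimately show ?thesis by (rule loop_computableI)
qed

lemma loop_computable_case_option [loop_computable_intros]:
  assumes "loop_computable f" "loop_computable a" "loop_computable (\<lambda>p. b (fst p) (snd p))"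
  shows "loop_computable (\<lambda>x. case f x of None \<Rightarrow> a x | Some y \<Rightarrow> b x y)"
  by (rule loop_computable_case_enc[OF assms]) (auto simp: enc_option_def split: option.split)

lemma enc_Cons: "enc (y # ys) = Suc (enc (y, ys))"
  by (simp add: enc_list_def enc_prod_def)

lemma loop_computable_case_list [loop_computable_intros]:
  assumes "loop_computable f" "loop_computable a"
    "loop_computable (\<lambda>p. b (fst p) (fst (snd p)) (snd (snd p)))"
  shows "loop_computable (\<lambda>x. case f x of [] \<Rightarrow> a x | y # ys \<Rightarrow> b x y ys)"
proof (rule loop_computable_case_enc[OF assms])
  fix x
  show "enc (f x) = 0 \<and> (case f x of [] \<Rightarrow> a x | y # ys \<Rightarrow> b x y ys) = a x \<or>
    (\<exists>y. enc (f x) = Suc (enc y) \<and> (case f x of [] \<Rightarrow> a x | y # ys \<Rightarrow> b x y ys) =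
      b (fst (x, y)) (fst (snd (x, y))) (snd (snd (x, y))))"
  proof (cases "f x")
    case Nil
    then show ?thesis by (simp add: enc_list_def)
  next
    case (Cons y ys)
    then show ?thesis by (auto simp: enc_Cons)
  qed
qed

lemma loop_computable_Some [loop_computable_intros]:
  assumes "loop_computable f"
  shows "loop_computable (\<lambda>x. Some (f x))"
proof -
  obtain f' where f': "implementable f'" "\<And>x. f' (enc x) = enc (f x)"
    using assms by (rule loop_computableE) blast
  show ?thesis
    by (rule loop_computableI[OF implementable_comp[OF implementable_Suc f'(1)]])
      (simp add: f'(2) enc_option_def)
qed

lemma loop_computable_Cons [loop_computable_intros]:
  assumes "loop_computable f" "loop_computable g"
  shows "loop_computable (\<lambda>x. f x # g x)"
proof -
  obtain h where h: "implementable h" "\<And>x. h (enc x) = enc (f x, g x)"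
    using loop_computable_Pair[OF assms] by (rule loop_computableE) blast
  show ?thesis
    by (rule loop_computableI[OF implementable_comp[OF implementable_Suc h(1)]])
      (simp add: h(2) enc_Cons)
qed

lemma length_le_enc: "length xs \<le> enc xs"
proof (induction xs)
  case (Cons x xs)
  then show ?case
    using le_prod_encode_2[of "enc xs" "enc x"] by (simp add: enc_Cons enc_prod_def)
qed simp

lemma loop_computable_fold [loop_computable_intros]:
  assumes "loop_computable (\<lambda>p. g (fst p) (fst (snd p)) (snd (snd p)))"
    "loop_computable l" "loop_computable a"
  shows "loop_computable (\<lambda>x. fold (g x) (l x) (a x))"
proof -
  let ?h = "\<lambda>x p. case fst p of [] \<Rightarrow> p | y # ys \<Rightarrow> (ys, g x y (snd p))"
  have "loop_computable (\<lambda>p. g (fst (fst p)) (fst (snd p)) (snd (snd (fst p))))"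
    using loop_computable_comp[OF assms(1), of "\<lambda>p. (fst (fst p), fst (snd p), snd (snd (fst p)))"]
    by (simp add: loop_computable_intros)
  then have "loop_computable (\<lambda>x. snd ((?h x ^^ enc (l x)) (l x, a x)))"
    by (intro loop_computable_intros assms)
  moreover have "snd ((?h x ^^ n) (ys, b)) = fold (g x) ys b" if "length ys \<le> n" for x n ys b
    using that
  proof (induction n arbitrary: ys b)
    case (Suc n)
    have "(?h x ^^ n) ([], b) = ([], b)" for b by (induction n) auto
    with Suc show ?case
      by (cases ys) (auto simp: funpow_Suc_right simp del: funpow.simps)
  qed simp
  ultimately show ?thesis by (simp add: length_le_enc)
qed

lemma loop_computable_rev [loop_computable_intros]:
  "loop_computable f \<Longrightarrow> loop_computable (\<lambda>x. rev (f x))"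
  unfolding rev_conv_fold by (intro loop_computable_intros)

lemma loop_computable_append [loop_computable_intros]:
  assumes "loop_computable f" "loop_computable g"
  shows "loop_computable (\<lambda>x. f x @ g x)"
proof -
  have "loop_computable (\<lambda>x. fold (#) (rev (f x)) (g x))"
    by (intro loop_computable_intros assms)
  then show ?thesis by (simp add: fold_Cons_rev)
qed

lemma loop_computable_map [loop_computable_intros]:
  assumes "loop_computable (\<lambda>p. g (fst p) (snd p))" "loop_computable l"
  shows "loop_computable (\<lambda>x. map (g x) (l x))"
proof -
  have "loop_computable (\<lambda>x. rev (fold (\<lambda>y ys. g x y # ys) (l x) []))"
    by (intro loop_computable_intros assms loop_computable_comp2[OF assms(1)])
  moreover have "fold (\<lambda>y ys. g x y # ys) xs zs = rev (map (g x) xs) @ zs" for x xs zs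
    by (induction xs arbitrary: zs) auto
  ultimately show ?thesis by simp
qed

lemma loop_computable_find [loop_computable_intros]:
  assumes "loop_computable (\<lambda>p. P (fst p) (snd p))" "loop_computable l"
  shows "loop_computable (\<lambda>x. find (P x) (l x))"
proof -
  let ?h = "\<lambda>x y z. if z = None \<and> P x y then Some y else z"
  have "loop_computable (\<lambda>x. fold (?h x) (l x) None)"
    by (intro loop_computable_intros assms loop_computable_comp2[OF assms(1)])
  moreover have "fold (?h x) xs None = find (P x) xs" for x xs
  proof -
    have "fold (?h x) ys (Some z) = Some z" for ys z by (induction ys) auto
    then show ?thesis by (induction xs) auto
  qed
  ultimately show ?thesis by simp
qed

lemma loop_computable_zip [loop_computable_intros]:
  fixes f :: "'a::enc \<Rightarrow> 'b::enc list" and g :: "'a \<Rightarrow> 'c::enc list"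
  assumes "loop_computable f" "loop_computable g"
  shows "loop_computable (\<lambda>x. zip (f x) (g x))"
proof -
  let ?h = "\<lambda>y p. case fst p of [] \<Rightarrow> p | z # zs \<Rightarrow> (zs, (y, z) # snd p)"
  have "loop_computable (\<lambda>x. rev (snd (fold ?h (f x) (g x, []))))"
    by (intro loop_computable_intros assms)
  moreover have "rev (snd (fold ?h ys (zs, ps))) = rev ps @ zip ys zs"
    for ys :: "'b list" and zs :: "'c list" and ps
    by (induction ys arbitrary: zs ps) (auto split: list.split)
  ultimately show ?thesis by simp
qed

lemma loop_computable_tl [loop_computable_intros]:
  "loop_computable f \<Longrightarrow> loop_computable (\<lambda>x. tl (f x))"
  unfolding tl_def by (intro loop_computable_intros)

lemma loop_computable_drop [loop_computable_intros]:
  fixes f :: "'a::enc \<Rightarrow> nat" and g :: "'a \<Rightarrow> 'b::enc list"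
  assumes "loop_computable f" "loop_computable g"
  shows "loop_computable (\<lambda>x. drop (f x) (g x))"
proof -
  have "loop_computable (\<lambda>x. (tl ^^ f x) (g x))"
    by (intro loop_computable_intros assms)
  moreover have "(tl ^^ n) xs = drop n xs" for n and xs :: "'b list"
    by (induction n) (auto simp: drop_Suc tl_drop)
  ultimately show ?thesis by simp
qed

lemma loop_computable_replicate [loop_computable_intros]:
  fixes f :: "'a::enc \<Rightarrow> nat" and g :: "'a \<Rightarrow> 'b::enc"
  assumes "loop_computable f" "loop_computable g"
  shows "loop_computable (\<lambda>x. replicate (f x) (g x))"
proof -
  have "loop_computable (\<lambda>x. ((#) (g x) ^^ f x) [])"
    by (intro loop_computable_intros assms loop_computable_comp[OF assms(2)])
  moreover have "((#) y ^^ n) [] = replicate n y" for n and y :: 'b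
    by (induction n) auto
  ultimately show ?thesis by simp
qed

section \<open>Simulation of machines\<close>

lemma loop_computable_rule_sel [loop_computable_intros]:
  fixes f :: "'a::enc \<Rightarrow> rule"
  assumes "loop_computable f"
  shows "loop_computable (\<lambda>x. r_state (f x))" "loop_computable (\<lambda>x. r_input (f x))"
    "loop_computable (\<lambda>x. r_work (f x))" "loop_computable (\<lambda>x. r_next (f x))"
    "loop_computable (\<lambda>x. r_advance (f x))" "loop_computable (\<lambda>x. r_emit (f x))"
proof -
  define fields where "fields = (\<lambda>r :: rule.
    (r_state r, r_input r, r_work r, r_next r, r_advance r, r_emit r, rule.more r))"
  have "loop_computable fields"
    by (rule loop_computable_if_enc_eq) (simp add: fields_def enc_rule_ext_def)
  note comp = loop_computable_comp[OF this assms]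
  have "loop_computable (\<lambda>x. fst (fields (f x)))"
    "loop_computable (\<lambda>x. fst (snd (fields (f x))))"
    "loop_computable (\<lambda>x. fst (snd (snd (fields (f x)))))"
    "loop_computable (\<lambda>x. fst (snd (snd (snd (fields (f x))))))"
    "loop_computable (\<lambda>x. fst (snd (snd (snd (snd (fields (f x)))))))"
    "loop_computable (\<lambda>x. fst (snd (snd (snd (snd (snd (fields (f x))))))))"
    by (intro loop_computable_intros comp)+
  then show "loop_computable (\<lambda>x. r_state (f x))" "loop_computable (\<lambda>x. r_input (f x))"
    "loop_computable (\<lambda>x. r_work (f x))" "loop_computable (\<lambda>x. r_next (f x))"
    "loop_computable (\<lambda>x. r_advance (f x))" "loop_computable (\<lambda>x. r_emit (f x))"
    by (simp_all add: fields_def)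
qed

lemma loop_computable_rule [loop_computable_intros]:
  assumes "loop_computable a" "loop_computable b" "loop_computable c" "loop_computable d"
    "loop_computable e" "loop_computable f"
  shows "loop_computable (\<lambda>x. \<lparr>r_state = a x, r_input = b x, r_work = c x, r_next = d x,
    r_advance = e x, r_emit = f x\<rparr>)"
proof -
  have "loop_computable (\<lambda>x. (a x, b x, c x, d x, e x, f x, ()))"
    by (intro loop_computable_intros assms)
  then show ?thesis by (simp add: loop_computable_def enc_rule_ext_def)
qed

lemma loop_computable_config_sel [loop_computable_intros]:
  fixes f :: "'a::enc \<Rightarrow> config"
  assumes "loop_computable f"
  shows "loop_computable (\<lambda>x. state (f x))" "loop_computable (\<lambda>x. pos (f x))"
    "loop_computable (\<lambda>x. tapes (f x))" "loop_computable (\<lambda>x. out (f x))"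
proof -
  define fields where "fields = (\<lambda>c :: config. (state c, pos c, tapes c, out c, config.more c))"
  have "loop_computable fields"
    by (rule loop_computable_if_enc_eq) (simp add: fields_def enc_config_ext_def)
  note comp = loop_computable_comp[OF this assms]
  have "loop_computable (\<lambda>x. fst (fields (f x)))"
    "loop_computable (\<lambda>x. fst (snd (fields (f x))))"
    "loop_computable (\<lambda>x. fst (snd (snd (fields (f x)))))"
    "loop_computable (\<lambda>x. fst (snd (snd (snd (fields (f x))))))"
    by (intro loop_computable_intros comp)+
  then show "loop_computable (\<lambda>x. state (f x))" "loop_computable (\<lambda>x. pos (f x))"
    "loop_computable (\<lambda>x. tapes (f x))" "loop_computable (\<lambda>x. out (f x))"
    by (simp_all add: fields_def)
qed

lemma loop_computable_config [loop_computable_intros]: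
  assumes "loop_computable a" "loop_computable b" "loop_computable c" "loop_computable d"
  shows "loop_computable (\<lambda>x. \<lparr>state = a x, pos = b x, tapes = c x, out = d x\<rparr>)"
proof -
  have "loop_computable (\<lambda>x. (a x, b x, c x, d x, ()))"
    by (intro loop_computable_intros assms)
  then show ?thesis by (simp add: loop_computable_def enc_config_ext_def)
qed

lemma loop_computable_decode_rule [loop_computable_intros]:
  "loop_computable f \<Longrightarrow> loop_computable (\<lambda>x. decode_rule (f x))"
  unfolding decode_rule_def decode_work_def decode_move_def decode_emit_def
  by (intro loop_computable_intros)

lemma loop_computable_rules [loop_computable_intros]:
  "loop_computable f \<Longrightarrow> loop_computable (\<lambda>x. rules (decode_machine (f x)))"
  by (simp add: decode_machine_def case_prod_beta loop_computable_intros)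

lemma loop_computable_init [loop_computable_intros]:
  "loop_computable f \<Longrightarrow> loop_computable (\<lambda>x. init (decode_machine (f x)))"
  by (simp add: init_def decode_machine_def case_prod_beta loop_computable_intros)

lemma first_sym_eq: "first_sym xs = (case xs of [] \<Rightarrow> 0 | y # ys \<Rightarrow> y)"
  by (cases xs) simp_all

lemma scanned_eq: "scanned T = first_sym (snd T)"
  by (cases T) simp

lemma tape_op_eq:
  "tape_op w T =
     (if snd (snd w) = Stay then (fst T, fst (snd w) # tl (snd T))
      else if snd (snd w) = Left then (tl (fst T), first_sym (fst T) # fst (snd w) # tl (snd T))
      else (fst (snd w) # fst T, tl (snd T)))"
  by (cases "(w, T)" rule: tape_op.cases) auto

lemma loop_computable_first_sym [loop_computable_intros]:
  "loop_computable f \<Longrightarrow> loop_computable (\<lambda>x. first_sym (f x))"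
  unfolding first_sym_eq by (intro loop_computable_intros)

lemma loop_computable_scanned [loop_computable_intros]:
  "loop_computable f \<Longrightarrow> loop_computable (\<lambda>x. scanned (f x))"
  unfolding scanned_eq by (intro loop_computable_intros)

lemma loop_computable_tape_op [loop_computable_intros]:
  assumes "loop_computable f" "loop_computable g"
  shows "loop_computable (\<lambda>x. tape_op (f x) (g x))"
  unfolding tape_op_eq by (intro loop_computable_intros assms)

lemma loop_computable_step [loop_computable_intros]:
  assumes "loop_computable e" "loop_computable n" "loop_computable c"
  shows "loop_computable (\<lambda>x. step (decode_machine (e x)) (nat_input (n x)) (c x))"
  unfolding step_def applicable_def apply_rule_def nat_input_def
  by (intro loop_computable_intros assms assms[THEN loop_computable_comp])

lemma loop_computable_run [loop_computable_intros]:
  assumes "loop_computable e" "loop_computable n" "loop_computable t"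
  shows "loop_computable (\<lambda>x. run (decode_machine (e x)) (nat_input (n x)) (t x))"
  unfolding run_def by (intro loop_computable_intros assms assms[THEN loop_computable_comp])

section \<open>Enumeration of semidecidable sets\<close>

theorem loop_computable_enumerable:
  fixes f :: "nat \<Rightarrow> nat \<Rightarrow> nat option"
  assumes "loop_computable (\<lambda>p. f (fst p) (snd p))"
  shows "\<exists>M. \<forall>e. enumerates M (nat_input e) = {c. \<exists>n. f e n = Some c}"
proof -
  have "loop_computable (\<lambda>p :: nat \<times> nat. (fst p, Suc (snd p)))"
    by (intro loop_computable_intros)
  then obtain succ where succ: "implementable succ"
    "\<And>p. succ (enc p) = enc (fst p :: nat, Suc (snd p))"
    by (rule loop_computableE) blast
  obtain g where g: "implementable g" "\<And>p. g (enc p) = enc (f (fst p) (snd p))"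
    using assms by (rule loop_computableE) blast
  have "loop_computable (\<lambda>e :: nat. (e, 0 :: nat))" by (intro loop_computable_intros)
  then obtain start where start: "implementable start" "\<And>e :: nat. start e = enc (e, 0 :: nat)"
    unfolding loop_computable_def enc_nat_def by blast
  obtain M where "\<And>e. enumerates M (nat_input e) = {c. \<exists>n. g ((succ ^^ n) (start e)) = Suc c}"
    using ex_machine_enumerating_orbit[OF succ(1) g(1) start(1)] by blast
  moreover have "(succ ^^ n) (start e) = enc (e, n)" for e n
    by (induction n) (simp_all add: start(2) succ(2))
  moreover have "enc (f e n) = Suc c \<longleftrightarrow> f e n = Some c" for e n c
    by (simp add: enc_option_def enc_nat_def split: option.split)
  ultimately show ?thesis by (auto simp: g(2))
qed

definition semidecidable :: "('a::enc \<Rightarrow> bool) \<Rightarrow> bool" where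
  "semidecidable P \<longleftrightarrow> (\<exists>R :: 'a \<Rightarrow> nat \<Rightarrow> bool.
     loop_computable (\<lambda>p. R (fst p) (snd p)) \<and> (\<forall>x. P x \<longleftrightarrow> (\<exists>n. R x n)))"

lemma semidecidableI:
  fixes R :: "'a::enc \<Rightarrow> nat \<Rightarrow> bool"
  assumes "loop_computable (\<lambda>p. R (fst p) (snd p))" "\<And>x. P x \<longleftrightarrow> (\<exists>n. R x n)"
  shows "semidecidable P"
  using assms by (auto simp: semidecidable_def)

lemma semidecidableE:
  assumes "semidecidable P"
  obtains R :: "'a::enc \<Rightarrow> nat \<Rightarrow> bool"
  where "loop_computable (\<lambda>p. R (fst p) (snd p))" "\<And>x. P x \<longleftrightarrow> (\<exists>n. R x n)"
  using assms by (auto simp: semidecidable_def)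

lemma loop_computable_imp_semidecidable:
  assumes "loop_computable P"
  shows "semidecidable P"
  by (rule semidecidableI[where R = "\<lambda>x _. P x"])
    (simp_all add: loop_computable_comp[OF assms] loop_computable_intros)

lemma semidecidable_disj:
  assumes "semidecidable P" "semidecidable Q"
  shows "semidecidable (\<lambda>x. P x \<or> Q x)"
proof -
  obtain R where R: "loop_computable (\<lambda>p. R (fst p) (snd p))" "\<And>x. P x \<longleftrightarrow> (\<exists>n :: nat. R x n)"
    using assms(1) by (rule semidecidableE) blast
  obtain S where S: "loop_computable (\<lambda>p. S (fst p) (snd p))" "\<And>x. Q x \<longleftrightarrow> (\<exists>n :: nat. S x n)"
    using assms(2) by (rule semidecidableE) blast
  show ?thesis
    by (rule semidecidableI[OF loop_computable_disj[OF R(1) S(1)]]) (auto simp: R(2) S(2))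
qed

lemma ex_prod_decode: "(\<exists>m. P (fst (prod_decode m)) (snd (prod_decode m))) \<longleftrightarrow> (\<exists>i j. P i j)"
  by (metis fst_conv prod_encode_inverse snd_conv)

lemma semidecidable_conj:
  assumes "semidecidable P" "semidecidable Q"
  shows "semidecidable (\<lambda>x. P x \<and> Q x)"
proof -
  obtain R where R: "loop_computable (\<lambda>p. R (fst p) (snd p))" "\<And>x. P x \<longleftrightarrow> (\<exists>n :: nat. R x n)"
    using assms(1) by (rule semidecidableE) blast
  obtain S where S: "loop_computable (\<lambda>p. S (fst p) (snd p))" "\<And>x. Q x \<longleftrightarrow> (\<exists>n :: nat. S x n)"
    using assms(2) by (rule semidecidableE) blast
  show ?thesis
  proof (rule semidecidableI)
    show "loop_computable (\<lambda>p. R (fst p) (fst (prod_decode (snd p))) \<and>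
        S (fst p) (snd (prod_decode (snd p))))"
      by (intro loop_computable_intros
          R(1)[THEN loop_computable_comp2] S(1)[THEN loop_computable_comp2])
    show "P x \<and> Q x \<longleftrightarrow> (\<exists>m. R x (fst (prod_decode m)) \<and> S x (snd (prod_decode m)))" for x
      by (simp add: R(2) S(2) ex_prod_decode[where P = "\<lambda>i j. R x i \<and> S x j"])
  qed
qed

lemma semidecidable_Ex:
  fixes P :: "'a::enc \<Rightarrow> nat \<Rightarrow> bool"
  assumes "semidecidable (\<lambda>p. P (fst p) (snd p))"
  shows "semidecidable (\<lambda>x. \<exists>n. P x n)"
proof -
  obtain R where R: "loop_computable (\<lambda>p. R (fst p) (snd p))"
    "\<And>p. P (fst p) (snd p) \<longleftrightarrow> (\<exists>n :: nat. R p n)"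
    using assms by (rule semidecidableE) blast
  show ?thesis
  proof (rule semidecidableI)
    show "loop_computable (\<lambda>p. R (fst p, fst (prod_decode (snd p))) (snd (prod_decode (snd p))))"
      by (intro loop_computable_intros R(1)[THEN loop_computable_comp2])
    show "(\<exists>n. P x n) \<longleftrightarrow> (\<exists>m. R (x, fst (prod_decode m)) (snd (prod_decode m)))" for x
      using R(2)[of "(x, _)"] by (simp add: ex_prod_decode[where P = "\<lambda>i j. R (x, i) j"])
  qed
qed

theorem semidecidable_enumerable:
  fixes P :: "nat \<Rightarrow> nat \<Rightarrow> bool"
  assumes "semidecidable (\<lambda>p. P (fst p) (snd p))"
  shows "\<exists>M. \<forall>e. enumerates M (nat_input e) = {c. P e c}"
proof -
  obtain R where R: "loop_computable (\<lambda>p. R (fst p) (snd p))"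
    "\<And>p. P (fst p) (snd p) \<longleftrightarrow> (\<exists>n :: nat. R p n)"
    using assms by (rule semidecidableE) blast
  define f where "f = (\<lambda>e m. if R (e, fst (prod_decode m)) (snd (prod_decode m))
    then Some (fst (prod_decode m)) else None)"
  have "loop_computable (\<lambda>p. f (fst p) (snd p))"
    unfolding f_def by (intro loop_computable_intros R(1)[THEN loop_computable_comp2])
  then obtain M where "\<And>e. enumerates M (nat_input e) = {c. \<exists>m. f e m = Some c}"
    using loop_computable_enumerable by blast
  moreover have "(\<exists>m. f e m = Some c) \<longleftrightarrow> P e c" for e c
    using R(2)[of "(e, c)"] ex_prod_decode[where P = "\<lambda>i j. R (e, i) j \<and> i = c"]
    by (auto simp: f_def)
  ultimately show ?thesis by auto
qed

section \<open>Certificates for programs of the top point\<close>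

definition certificate :: "nat \<Rightarrow> nat \<Rightarrow> bool" where
  "certificate e z \<longleftrightarrow>
     (case prod_decode z of (n, t) \<Rightarrow> out (run (decode_machine e) (nat_input n) t) \<noteq> [])"

definition certified :: "nat \<Rightarrow> bool" where
  "certified e \<longleftrightarrow> (\<exists>z. certificate e z)"

lemma loop_computable_certificate [loop_computable_intros]:
  assumes "loop_computable e" "loop_computable z"
  shows "loop_computable (\<lambda>x. certificate (e x) (z x))"
  unfolding certificate_def by (intro loop_computable_intros assms)

lemma semidecidable_certified:
  assumes "loop_computable e"
  shows "semidecidable (\<lambda>x. certified (e x))"
  unfolding certified_def
  by (intro semidecidable_Ex loop_computable_imp_semidecidable loop_computable_intros
      loop_computable_comp[OF assms])

lemma type2_name_Bot: "type2_name p Bot \<longleftrightarrow> range p = {0}"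
proof -
  have "{i. i < length sierpinski_base \<and> Bot \<in> sierpinski_base ! i} = {0}"
    by (auto simp: sierpinski_base_def less_Suc_eq)
  then show ?thesis by (simp add: type2_name_def)
qed

lemma type2_name_Top: "type2_name p Top \<longleftrightarrow> range p = {0, 1}"
proof -
  have "{i. i < length sierpinski_base \<and> Top \<in> sierpinski_base ! i} = {0, 1}"
    by (auto simp: sierpinski_base_def less_Suc_eq)
  then show ?thesis by (simp add: type2_name_def)
qed

lemma out_run_prefix_halted:
  assumes "halted M inp (run M inp t')"
  shows "\<exists>v. out (run M inp t') = out (run M inp t) @ v"
proof (cases "t \<le> t'")
  case True
  then show ?thesis by (rule out_run_mono)
next
  case False
  then show ?thesis using run_halted[OF assms, of "t - t'"] by simp
qed

lemma not_certified_if_Bot: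
  assumes "markov_name e Bot"
  shows "\<not> certified e"
proof -
  obtain p where p: "computes (decode_machine e) p" and "range p = {0}"
    using assms by (auto simp: markov_name_def type2_name_Bot)
  have "out (run (decode_machine e) (nat_input n) t) = []" for n t
  proof -
    let ?run = "run (decode_machine e) (nat_input n)"
    have "p n = 0" using \<open>range p = {0}\<close> by auto
    then obtain t' where "halted (decode_machine e) (nat_input n) (?run t')" "out (?run t') = []"
      using p[unfolded computes_def, rule_format, of n] by auto
    then show ?thesis using out_run_prefix_halted by (metis append_is_Nil_conv)
  qed
  then show ?thesis by (simp add: certified_def certificate_def split: prod.split)
qed

lemma certified_if_Top:
  assumes "markov_name e Top"
  shows "certified e"
proof -
  obtain p where p: "computes (decode_machine e) p" "range p = {0, 1}"
    using assms by (auto simp: markov_name_def type2_name_Top)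
  then obtain n where "p n = 1" by (metis imageE insertI1 insertI2)
  then obtain t where "out (run (decode_machine e) (nat_input n) t) = [True]"
    using p(1)[unfolded computes_def, rule_format, of n] by auto
  then have "certificate e (prod_encode (n, t))" by (simp add: certificate_def)
  then show ?thesis unfolding certified_def ..
qed

section \<open>The separating function\<close>

definition escape_set :: "nat \<Rightarrow> (nat \<Rightarrow> nat) set" where
  "escape_set e = {y. \<not> certificate e (y e)}"

definition escapes :: "nat \<Rightarrow> nat \<Rightarrow> bool" where
  "escapes e c \<longleftrightarrow> e < length (list_decode c) \<and> \<not> certificate e (list_decode c ! e)"

lemma escapes_eq_case_drop:
  "escapes e c \<longleftrightarrow> (case drop e (list_decode c) of [] \<Rightarrow> False | z # zs \<Rightarrow> \<not> certificate e z)"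
  by (cases "e < length (list_decode c)") (simp_all add: escapes_def Cons_nth_drop_Suc[symmetric])

lemma loop_computable_escapes [loop_computable_intros]:
  assumes "loop_computable e" "loop_computable c"
  shows "loop_computable (\<lambda>x. escapes (e x) (c x))"
  unfolding escapes_eq_case_drop
  by (intro loop_computable_intros assms loop_computable_comp[OF assms(1)])

lemma escape_set_eq_UN_cylinder: "escape_set e = (\<Union>c\<in>{c. escapes e c}. cylinder (list_decode c))"
proof (intro equalityI subsetI)
  fix y assume y: "y \<in> escape_set e"
  let ?c = "list_encode (map y [0..<Suc e])"
  have "escapes e ?c" using y by (simp add: escapes_def escape_set_def del: upt_Suc)
  moreover have "y \<in> cylinder (list_decode ?c)" by (simp add: cylinder_def del: upt_Suc)
  ultimately show "y \<in> (\<Union>c\<in>{c. escapes e c}. cylinder (list_decode c))" by blast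
next
  fix y assume "y \<in> (\<Union>c\<in>{c. escapes e c}. cylinder (list_decode c))"
  then show "y \<in> escape_set e" by (auto simp: escapes_def escape_set_def cylinder_def)
qed

lemma open_escape_set: "open (escape_set e)"
proof -
  have "escape_set e = (\<lambda>y. y e) -` {z. \<not> certificate e z}" by (auto simp: escape_set_def)
  also have "open \<dots>" by (intro open_vimage open_discrete) simp
  finally show ?thesis .
qed

definition top_set :: "(nat \<Rightarrow> nat) set" where
  "top_set = (\<Union>e\<in>{e. certified e}. escape_set e)"

lemma top_set_neq_UNIV: "top_set \<noteq> UNIV"
proof -
  have "certificate e (SOME z. certificate e z)" if "certified e" for e
    using that unfolding certified_def by (rule someI_ex)
  then have "(\<lambda>e. SOME z. certificate e z) \<notin> top_set"
    by (auto simp: top_set_def escape_set_def)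
  then show ?thesis by blast
qed

primrec sep_fun :: "sierpinski \<Rightarrow> (nat \<Rightarrow> nat) set" where
  "sep_fun Bot = UNIV"
| "sep_fun Top = top_set"

lemma open_sep_fun: "open (sep_fun s)"
  by (cases s) (auto simp: top_set_def intro: open_escape_set)

lemma sep_fun_markov_name:
  assumes "markov_name e s"
  shows "sep_fun s = escape_set e \<union> (if certified e then top_set else {})"
proof (cases s)
  case Bot
  then have "\<not> certified e" using assms not_certified_if_Bot by simp
  then show ?thesis using Bot by (auto simp: certified_def escape_set_def)
next
  case Top
  then have "certified e" using assms certified_if_Top by simp
  then show ?thesis using Top by (auto simp: top_set_def)
qed

lemma markov_computable_sep_fun: "markov_computable sep_fun"
proof -
  define listed where
    "listed = (\<lambda>e c. escapes e c \<or> certified e \<and> (\<exists>e'. certified e' \<and> escapes e' c))"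
  have "semidecidable (\<lambda>p. listed (fst p) (snd p))"
    unfolding listed_def
    by (intro semidecidable_disj semidecidable_conj semidecidable_Ex semidecidable_certified
        loop_computable_imp_semidecidable loop_computable_intros)
  then obtain M where M: "\<And>e. enumerates M (nat_input e) = {c. listed e c}"
    using semidecidable_enumerable by blast
  have "(\<Union>c\<in>{c. listed e c}. cylinder (list_decode c)) =
      escape_set e \<union> (if certified e then top_set else {})" for e
    by (auto simp: listed_def top_set_def escape_set_eq_UN_cylinder)
  then have "outputs_open M (nat_input e) (sep_fun s)" if "markov_name e s" for e s
    using sep_fun_markov_name[OF that] by (simp add: outputs_open_def M)
  then show ?thesis unfolding markov_computable_def by blast
qed

section \<open>Monotonicity of K-computable functions\<close>

lemma run_cong:
  assumes "\<And>i. i < t \<Longrightarrow> inp i = inp' i"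
  shows "run M inp t = run M inp' t"
proof -
  have "run M inp u = run M inp' u \<and> pos (run M inp u) \<le> u" if "u \<le> t" for u
    using that
  proof (induction u)
    case 0
    then show ?case by (simp add: run_def init_def)
  next
    case (Suc u)
    let ?c = "run M inp u"
    have eq: "run M inp' u = ?c" and pos: "pos ?c \<le> u" using Suc by auto
    then have "applicable inp ?c = applicable inp' ?c"
      using Suc.prems assms by (auto simp: applicable_def fun_eq_iff)
    then have "step M inp ?c = step M inp' ?c" by (simp add: step_def)
    moreover have "pos (step M inp ?c) \<le> Suc (pos ?c)"
      by (auto simp: step_def apply_rule_def split: option.splits)
    ultimately show ?case using eq pos by (simp add: run_def)
  qed
  then show ?thesis by blast
qed

lemma enumerates_finite_input:
  assumes "c \<in> enumerates M inp"
  obtains t where "\<And>inp'. (\<And>i. i < t \<Longrightarrow> inp i = inp' i) \<Longrightarrow> c \<in> enumerates M inp'"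
proof -
  from assms obtain t where "c \<in> set (blocks 0 (out (run M inp t)))"
    by (auto simp: enumerates_def)
  then have "c \<in> enumerates M inp'" if "\<And>i. i < t \<Longrightarrow> inp i = inp' i" for inp'
    using run_cong[OF that] by (auto simp: enumerates_def)
  then show thesis by (rule that)
qed

lemma seq_input_cong:
  assumes "\<And>j. j \<le> i \<Longrightarrow> p j = q j"
  shows "seq_input p i = seq_input q i"
proof -
  have "i = n + (\<Sum>j\<le>n. p j) \<longleftrightarrow> i = n + (\<Sum>j\<le>n. q j)" for n
  proof (cases "n \<le> i")
    case True
    then have "(\<Sum>j\<le>n. p j) = (\<Sum>j\<le>n. q j)" using assms by (intro sum.cong) auto
    then show ?thesis by simp
  qed auto
  then show ?thesis by (simp add: seq_input_def)
qed

lemma ex_common_K_bound: "\<exists>k. \<forall>s. K s \<le> enat k"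
proof -
  have "\<exists>k. K s \<le> enat k" for s
  proof -
    obtain e where "markov_name e s"
      using ex_markov_name_Bot ex_markov_name_Top by (cases s) auto
    then have "K s \<le> enat (program_length e)" unfolding K_def by (auto intro: INF_lower)
    then show ?thesis ..
  qed
  then obtain f where f: "\<And>s. K s \<le> enat (f s)" by metis
  have "K s \<le> enat (max (f Bot) (f Top))" for s
    using f[of s] by (cases s) (auto elim: order_trans)
  then show ?thesis by blast
qed

theorem K_computable_imp_mono:
  assumes "K_computable F"
  shows "F Bot \<subseteq> F Top"
proof
  fix y assume y: "y \<in> F Bot"
  obtain M where M: "\<And>s k p. K_name k p s \<Longrightarrow> outputs_open M (seq_input (case_nat k p)) (F s)"
    using assms unfolding K_computable_def by blast
  obtain k where k: "\<And>s. K s \<le> enat k" using ex_common_K_bound by blast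
  have "K_name k (\<lambda>_. 0) Bot" using k by (auto simp: K_name_def type2_name_Bot)
  with y obtain c where c: "c \<in> enumerates M (seq_input (case_nat k (\<lambda>_. 0)))"
    and yc: "y \<in> cylinder (list_decode c)"
    by (auto dest!: M simp: outputs_open_def)
  from c obtain t where t: "\<And>inp. (\<And>i. i < t \<Longrightarrow> seq_input (case_nat k (\<lambda>_. 0)) i = inp i) \<Longrightarrow>
      c \<in> enumerates M inp"
    by (rule enumerates_finite_input) blast
  define p :: "nat \<Rightarrow> nat" where "p j = of_bool (j = t)" for j
  have "0 = p (Suc t)" "1 = p t" by (simp_all add: p_def)
  then have "{0, 1} \<subseteq> range p" by blast
  moreover have "range p \<subseteq> {0, 1}" by (auto simp: p_def)
  ultimately have "range p = {0, 1}" by (rule subset_antisym[rotated])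
  then have "K_name k p Top" using k by (simp add: K_name_def type2_name_Top)
  moreover have "c \<in> enumerates M (seq_input (case_nat k p))"
    by (intro t seq_input_cong) (auto simp: p_def split: nat.split)
  ultimately show "y \<in> F Top" using M yc by (auto simp: outputs_open_def)
qed

theorem mainTheorem15:
  shows "\<exists>F :: sierpinski \<Rightarrow> (nat \<Rightarrow> nat) set.
           (\<forall>s. open (F s)) \<and> markov_computable F \<and> \<not> K_computable F"
proof (intro exI[of _ sep_fun] conjI allI notI)
  show "open (sep_fun s)" for s by (rule open_sep_fun)
  show "markov_computable sep_fun" by (rule markov_computable_sep_fun)
  assume "K_computable sep_fun"
  then have "sep_fun Bot \<subseteq> sep_fun Top" by (rule K_computable_imp_mono)
  then show False using top_set_neq_UNIV by auto
qed

end
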